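(* Let $(X,Y,Z)$ be a real-valued centered Gaussian random vector (jointly Gaussian with mean zero) in $\mathbb{R}^3$ such that each of $X,Y,Z$ has positive variance. Then for every $m\in\mathbb{N}$, $$\mathbf{E}\left[X^{2m}Y^{2m}Z^{2m}\right]\geq \mathbf{E}[X^{2m}]\,\mathbf{E}[Y^{2m}]\,\mathbf{E}[Z^{2m}].$$ Moreover, for every $m\in\mathbb{N}$, equality holds if and only if $X,Y,Z$ are independent.
   Context: $\mathbb{N}=\{1,2,3,\dots\}$. $\mathbf{E}$ denotes expectation. The covariance matrix of $(X,Y,Z)$ is allowed to be singular; only the individual components are required to be non-degenerate (positive variance). *)

theory Defs
  imports "HOL-Probability.Probability"
begin

text \<open>
  The library's \<open>distributed M lborel X (normal_density \<mu> \<sigma>)\<close> covers only \<open>\<sigma> > 0\<close>; point masses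
  are included here as the normal laws of variance zero, so that singular covariance matrices
  are allowed below.
\<close>

definition gaussian_var :: "'a measure \<Rightarrow> ('a \<Rightarrow> real) \<Rightarrow> bool" where
  "gaussian_var M X \<longleftrightarrow> X \<in> borel_measurable M \<and>
     ((\<exists>\<mu>. AE \<omega> in M. X \<omega> = \<mu>) \<or>
      (\<exists>\<mu> \<sigma>. \<sigma> > 0 \<and> distributed M lborel X (normal_density \<mu> \<sigma>)))"

definition gaussian_vector :: "'a measure \<Rightarrow> ('a \<Rightarrow> 'b::euclidean_space) \<Rightarrow> bool" where
  "gaussian_vector M V \<longleftrightarrow> V \<in> borel_measurable M \<and> (\<forall>u. gaussian_var M (\<lambda>\<omega>. u \<bullet> V \<omega>))"

definition centered_gaussian_vector :: "'a measure \<Rightarrow> ('a \<Rightarrow> 'b::euclidean_space) \<Rightarrow> bool" where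
  "centered_gaussian_vector M V \<longleftrightarrow> gaussian_vector M V \<and> prob_space.expectation M V = 0"

end

theory Submission
  imports Defs
begin

text \<open>
  Normalise to unit variances. Then \<open>A = X + Y\<close> and \<open>B = X - Y\<close> are independent, \<open>4 X Y = A\<^sup>2 - B\<^sup>2\<close>,
  and \<open>Z = \<alpha> A + \<beta> B + W\<close> with \<open>W\<close> independent of \<open>(A, B)\<close>. Expanding \<open>Z ^ (2 * m)\<close> reduces
  the inequality, term by term, to a lower bound for
  \<open>h j l c = E[a ^ (2 * j) * b ^ (2 * l) * ((1 + c) a\<^sup>2 - (1 - c) b\<^sup>2) ^ (2 * m)] / (E[a ^ (2 * j)] E[b ^ (2 * l)])\<close>,
  where \<open>a\<close> and \<open>b\<close> are independent standard normal and \<open>c\<close> is the correlation of \<open>X\<close> and \<open>Y\<close>: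
  it is at least \<open>h 0 0 0\<close>, with equality only for \<open>j = l = 0\<close> and \<open>c = 0\<close>.

  For \<open>j = l = 0\<close> this follows from convexity and symmetry in \<open>c\<close>. Gaussian integration by parts
  gives \<open>h j l c = h (j + 1) l c - k (1 + c) h' (j + 1) l c\<close> with \<open>k = 1 / (j + l + 2 m + 1)\<close> and \<open>h'\<close> the
  derivative in \<open>c\<close>, so convexity yields \<open>h (j + 1) l (c - k (1 + c)) \<ge> h j l c\<close>, and
  \<open>c \<mapsto> c - k (1 + c)\<close> is a bijection of the real line.
\<close>

section \<open>Gaussian integration by parts\<close>

text \<open>The rule for bounded linear maps matches every goal, so it stands last, where the
  selection \<open>(1-5)\<close> drops it.\<close>

lemmas real_polynomial_function_intros = real_polynomial_function.intros(2-4)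
  real_polynomial_function_diff real_polynomial_function_power real_polynomial_function.intros(1)

text \<open>The base \<open>1 + norm x\<close> is at least 1, so two bounds can be brought to a
  common exponent; evaluation at 0 shows that the constants are nonnegative.\<close>

lemma real_polynomial_function_bound:
  assumes "real_polynomial_function p"
  shows "\<exists>C n. \<forall>x. \<bar>p x\<bar> \<le> C * (1 + norm x) ^ n"
  using assms
proof induction
  case (linear f)
  then obtain K where "\<And>x. norm (f x) \<le> norm x * K" "K > 0"
    using bounded_linear.pos_bounded by blast
  then have "\<bar>f x\<bar> \<le> K * (1 + norm x) ^ 1" for x
    by (simp add: algebra_simps add_increasing)
  then show ?case by blast
next
  case (const c)
  have "\<bar>c\<bar> \<le> \<bar>c\<bar> * (1 + norm (x::'a)) ^ 0" for x by simp
  then show ?case by blast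
next
  case (add f g)
  then obtain C n D k where f: "\<And>x. \<bar>f x\<bar> \<le> C * (1 + norm x) ^ n" and g: "\<And>x. \<bar>g x\<bar> \<le> D * (1 + norm x) ^ k"
    by blast
  have "\<bar>f x + g x\<bar> \<le> (C + D) * (1 + norm x) ^ (n + k)" for x
  proof -
    have "C \<ge> 0" "D \<ge> 0" using f[of 0] g[of 0] by auto
    then have "C * (1 + norm x) ^ n \<le> C * (1 + norm x) ^ (n + k)" "D * (1 + norm x) ^ k \<le> D * (1 + norm x) ^ (n + k)"
      by (auto intro!: mult_left_mono power_increasing)
    then show ?thesis using f[of x] g[of x] by (simp add: algebra_simps)
  qed
  then show ?case by blast
next
  case (mult f g)
  then obtain C n D k where f: "\<And>x. \<bar>f x\<bar> \<le> C * (1 + norm x) ^ n" and g: "\<And>x. \<bar>g x\<bar> \<le> D * (1 + norm x) ^ k"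
    by blast
  have "\<bar>f x * g x\<bar> \<le> (C * D) * (1 + norm x) ^ (n + k)" for x
    using mult_mono[OF f g, of x x] f[of x] by (simp add: abs_mult power_add algebra_simps)
  then show ?case by blast
qed

text \<open>Moments of the coordinates suffice: the norm is at most the dimension times the largest
  absolute coordinate, so each of its powers is dominated by a multiple of the sum of the absolute
  coordinate powers.\<close>

lemma integrable_real_polynomial_function:
  fixes V :: "'a \<Rightarrow> 'b::euclidean_space"
  assumes p: "real_polynomial_function p" and [measurable]: "V \<in> borel_measurable M"
    and V: "\<And>b n. b \<in> Basis \<Longrightarrow> integrable M (\<lambda>\<omega>. (V \<omega> \<bullet> b) ^ n)"
  shows "integrable M (\<lambda>\<omega>. p (V \<omega>))"
proof -
  have norm_int: "integrable M (\<lambda>\<omega>. norm (V \<omega>) ^ n)" for n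
  proof (rule Bochner_Integration.integrable_bound)
    show "integrable M (\<lambda>\<omega>. real (DIM('b)) ^ n * (\<Sum>b\<in>Basis. \<bar>(V \<omega> \<bullet> b) ^ n\<bar>))"
      using V by (intro integrable_mult_right Bochner_Integration.integrable_sum integrable_abs) auto
    have "norm x ^ n \<le> real (DIM('b)) ^ n * (\<Sum>b\<in>Basis. \<bar>(x \<bullet> b) ^ n\<bar>)" for x :: 'b
    proof -
      have "infnorm x \<in> {\<bar>x \<bullet> b\<bar> | b. b \<in> Basis}"
        unfolding infnorm_Max Setcompr_eq_image by (rule Max_in) auto
      then obtain b :: 'b where b: "b \<in> Basis" "infnorm x = \<bar>x \<bullet> b\<bar>" by auto
      have "norm x ^ n \<le> (real DIM('b) * infnorm x) ^ n"
      proof (rule power_mono)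
        have "norm x \<le> (\<Sum>b\<in>Basis. \<bar>x \<bullet> b\<bar>)" by (rule norm_le_l1)
        also have "\<dots> \<le> (\<Sum>b\<in>(Basis::'b set). infnorm x)" by (intro sum_mono Basis_le_infnorm)
        finally show "norm x \<le> real DIM('b) * infnorm x" by simp
      qed simp
      also have "\<dots> = real DIM('b) ^ n * \<bar>(x \<bullet> b) ^ n\<bar>" 
        by (simp add: power_mult_distrib b power_abs)
      also have "\<dots> \<le> real (DIM('b)) ^ n * (\<Sum>b\<in>Basis. \<bar>(x \<bullet> b) ^ n\<bar>)"
        using b by (intro mult_left_mono member_le_sum) auto
      finally show ?thesis .
    qed
    then show "AE \<omega> in M. norm (norm (V \<omega>) ^ n) \<le> norm (real (DIM('b)) ^ n * (\<Sum>b\<in>Basis. \<bar>(V \<omega> \<bullet> b) ^ n\<bar>))"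
      by (intro AE_I2) (simp add: abs_mult sum_nonneg)
  qed simp
  obtain C n where C: "\<And>x. \<bar>p x\<bar> \<le> C * (1 + norm x) ^ n"
    using real_polynomial_function_bound[OF p] by blast
  have "continuous_on UNIV p" 
    by (simp add: continuous_on_polymonial_function p flip: real_polynomial_function_eq)
  then have [measurable]: "p \<in> borel_measurable borel" by (rule borel_measurable_continuous_onI)
  show ?thesis
  proof (rule Bochner_Integration.integrable_bound)
    show "integrable M (\<lambda>\<omega>. C * (norm (V \<omega>) + 1) ^ n)"
      unfolding binomial_ring
      by (intro integrable_mult_right Bochner_Integration.integrable_sum integrable_mult_left norm_int)
    show "AE \<omega> in M. norm (p (V \<omega>)) \<le> norm (C * (norm (V \<omega>) + 1) ^ n)"
      by (intro AE_I2) (metis C abs_ge_self add.commute order_trans real_norm_def)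
  qed simp
qed

section \<open>The standard normal law on the line\<close>

interpretation std_normal: prob_space std_normal_distribution
  by (rule prob_space_normal_density) simp

interpretation std_normal_pair: pair_prob_space std_normal_distribution std_normal_distribution ..

abbreviation normal_moment :: "nat \<Rightarrow> real" where
  "normal_moment n \<equiv> (LINT x|std_normal_distribution. x ^ n)"

text \<open>For even \<open>n\<close> this is a quotient of the factorial formulas; for odd
  \<open>n\<close> both sides vanish.\<close>

lemma normal_moment_Suc_Suc: "normal_moment (Suc (Suc n)) = (n + 1) * normal_moment n"
proof (cases "even n")
  case True
  then obtain k where n: "n = 2 * k" by auto
  have "Suc (Suc n) = 2 * Suc k" using n by simp
  then have "normal_moment (Suc (Suc n)) = fact (2 * Suc k) / (2 ^ Suc k * fact (Suc k))"
    by (metis std_normal_distribution_even_moments(1))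
  also have "\<dots> = (2 * (real k + 1) * ((2 * real k + 1) * fact (2 * k))) / (2 * (real k + 1) * (2 ^ k * fact k))"
    by (simp add: algebra_simps)
  also have "\<dots> = (n + 1) * (fact (2 * k) / (2 ^ k * fact k))"
    unfolding n by (subst mult_divide_mult_cancel_left) (auto simp: add_eq_0_iff)
  finally show ?thesis unfolding n std_normal_distribution_even_moments(1) by simp
next
  case False
  then show ?thesis
    by (subst (1 2) integral_std_normal_distribution_moment_odd) auto
qed

lemma normal_moment_0: "normal_moment 0 = 1"
  using std_normal.prob_space by simp

lemma normal_moment_2: "normal_moment 2 = 1"
  using normal_moment_Suc_Suc[of 0] normal_moment_0 by (simp add: numeral_2_eq_2)

lemma normal_moment_even_pos: "even n \<Longrightarrow> normal_moment n > 0"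
  by (auto elim!: evenE simp: std_normal_distribution_even_moments)

text \<open>Stein's identity. Both sides are linear in \<open>f\<close>, and on monomials it is the
  moment recurrence, so no boundary terms have to be estimated.\<close>

lemma std_normal_integral_by_parts:
  assumes f: "real_polynomial_function f"
    and f': "\<And>x. (f has_real_derivative f' x) (at x)"
  shows "(LINT x|std_normal_distribution. x * f x) = (LINT x|std_normal_distribution. f' x)"
proof -
  obtain a n where a: "f = (\<lambda>x. \<Sum>i\<le>n. a i * x ^ i)"
    using f real_polynomial_function_iff_sum by blast
  have "((\<lambda>x. \<Sum>i\<le>n. a i * x ^ i) has_real_derivative (\<Sum>i\<le>n. a i * (i * x ^ (i - 1)))) (at x)" for x :: real
    by (auto intro!: derivative_eq_intros simp: ac_simps)
  then have f'_eq: "f' = (\<lambda>x::real. \<Sum>i\<le>n. a i * (i * x ^ (i - 1)))"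
    using DERIV_unique[OF f'[unfolded a]] by (intro ext) blast
  \<comment> \<open>At \<open>i = 0\<close> the truncated \<open>i - 1\<close> is harmless: the
    factor \<open>i\<close> vanishes, and so does the first moment.\<close>
  have 1: "normal_moment (Suc i) = i * normal_moment (i - 1)" for i
  proof (cases i)
    case 0
    then show ?thesis using integral_std_normal_distribution_moment_odd[of 1] by simp
  next
    case (Suc k)
    then show ?thesis using normal_moment_Suc_Suc[of k] by (simp del: power_Suc)
  qed
  have "(LINT x|std_normal_distribution. x * f x) = (LINT x|std_normal_distribution. (\<Sum>i\<le>n. a i * x ^ Suc i))"
    unfolding a by (simp add: sum_distrib_left mult.left_commute)
  also have "\<dots> = (\<Sum>i\<le>n. a i * normal_moment (Suc i))"
    by (subst Bochner_Integration.integral_sum)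
       (auto intro!: integrable_mult_right integrable_std_normal_distribution_moment simp del: power_Suc)
  also have "\<dots> = (LINT x|std_normal_distribution. f' x)"
    unfolding 1 f'_eq
    by (subst Bochner_Integration.integral_sum)
       (auto intro!: integrable_mult_right integrable_std_normal_distribution_moment)
  finally show ?thesis .
qed

section \<open>Pairs of independent standard normal variables\<close>

abbreviation std_normal2 :: "(real \<times> real) measure" where
  "std_normal2 \<equiv> std_normal_distribution \<Otimes>\<^sub>M std_normal_distribution"

lemma integrable_std_normal2_marginal: 
  fixes f :: "real \<Rightarrow> real"
  assumes "integrable std_normal_distribution f"
  shows "integrable std_normal2 (\<lambda>z. f (fst z))" "integrable std_normal2 (\<lambda>z. f (snd z))"
proof -
  show "integrable std_normal2 (\<lambda>z. f (fst z))"
    using assms std_normal.distr_pair_fst[of std_normal_distribution]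
    by (intro integrable_distr[of fst _ std_normal_distribution]) auto
  then show "integrable std_normal2 (\<lambda>z. f (snd z))"
    by (subst std_normal_pair.integrable_product_swap_iff[symmetric]) (simp add: case_prod_unfold)
qed

lemma integrable_std_normal2_polynomial:
  assumes "real_polynomial_function p" shows "integrable std_normal2 p"
proof (rule integrable_real_polynomial_function[OF assms, of "\<lambda>x. x"])
  show "(\<lambda>x. x) \<in> borel_measurable std_normal2"
    unfolding borel_prod[symmetric] by simp
next
  fix b :: "real \<times> real" and n :: nat assume "b \<in> Basis"
  then consider "b = (1, 0)" | "b = (0, 1)" by (auto simp: Basis_prod_def)
  then show "integrable std_normal2 (\<lambda>z. (z \<bullet> b) ^ n)"
    by cases (auto simp: inner_prod_def intro!: integrable_std_normal2_marginal integrable_std_normal_distribution_moment)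
qed

text \<open>A linear \<open>f\<close> satisfies \<open>f (x, y) = f (x, 0) + f (0, y)\<close>, which
  is linear plus constant in either variable; sums and products are immediate. This allows
  one-dimensional integration by parts on the slices.\<close>

lemma real_polynomial_function_Pair:
  fixes f :: "real \<times> real \<Rightarrow> real"
  assumes "real_polynomial_function f"
  shows "real_polynomial_function (\<lambda>x. f (x, y))" "real_polynomial_function (\<lambda>x. f (y, x))"
proof -
  have "real_polynomial_function (\<lambda>x::real. f (x, y)) \<and> real_polynomial_function (\<lambda>x. f (y, x))"
    using assms
  proof induction
    case (linear f)
    then interpret bounded_linear f .
    have "real_polynomial_function (\<lambda>x. f (x, 0) + f (0, y))" "real_polynomial_function (\<lambda>x. f (0, x) + f (y, 0))"
      by (intro real_polynomial_function_intros bounded_linear_compose[OF \<open>bounded_linear f\<close>] bounded_linear_Pair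
          bounded_linear_ident bounded_linear_zero)+
    then show ?case by (simp flip: add)
  qed auto
  then show "real_polynomial_function (\<lambda>x. f (x, y))" "real_polynomial_function (\<lambda>x. f (y, x))"
    by auto
qed

lemma real_polynomial_function_fst [intro]: "real_polynomial_function (\<lambda>z::real \<times> real. fst z)"
  and real_polynomial_function_snd [intro]: "real_polynomial_function (\<lambda>z::real \<times> real. snd z)"
  by (intro real_polynomial_function.intros(1) bounded_linear_fst bounded_linear_snd)+

lemmas real_polynomial_function_intros2 = real_polynomial_function_intros(1-5)
  real_polynomial_function_fst real_polynomial_function_snd

text \<open>Fubini with the first variable innermost, then Stein's identity on each slice.\<close>

lemma std_normal2_integral_fst_by_parts:
  assumes f: "real_polynomial_function f" and f': "real_polynomial_function f'"
    and D: "\<And>x y. ((\<lambda>x. f (x, y)) has_real_derivative f' (x, y)) (at x)"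
  shows "(LINT z|std_normal2. fst z * f z) = (LINT z|std_normal2. f' z)"
proof -
  have "(LINT z|std_normal2. fst z * f z)
      = (LINT y|std_normal_distribution. LINT x|std_normal_distribution. x * f (x, y))"
    using f by (subst std_normal_pair.integral_snd)
      (auto simp: case_prod_unfold intro!: integrable_std_normal2_polynomial real_polynomial_function.intros(4))
  also have "\<dots> = (LINT y|std_normal_distribution. LINT x|std_normal_distribution. f' (x, y))"
    by (intro Bochner_Integration.integral_cong refl std_normal_integral_by_parts real_polynomial_function_Pair f D)
  also have "\<dots> = (LINT z|std_normal2. f' z)"
    using f' by (subst std_normal_pair.integral_snd)
      (auto simp: case_prod_unfold intro!: integrable_std_normal2_polynomial)
  finally show ?thesis .
qed

lemma std_normal2_integral_snd_by_parts:
  assumes f: "real_polynomial_function f" and f': "real_polynomial_function f'"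
    and D: "\<And>x y. ((\<lambda>y. f (x, y)) has_real_derivative f' (x, y)) (at y)"
  shows "(LINT z|std_normal2. snd z * f z) = (LINT z|std_normal2. f' z)"
proof -
  have "(LINT z|std_normal2. snd z * f z)
      = (LINT x|std_normal_distribution. LINT y|std_normal_distribution. y * f (x, y))"
    using f by (subst std_normal_pair.integral_fst)
      (auto simp: case_prod_unfold intro!: integrable_std_normal2_polynomial real_polynomial_function.intros(4))
  also have "\<dots> = (LINT x|std_normal_distribution. LINT y|std_normal_distribution. f' (x, y))"
    by (intro Bochner_Integration.integral_cong refl std_normal_integral_by_parts real_polynomial_function_Pair f D)
  also have "\<dots> = (LINT z|std_normal2. f' z)"
    using f' by (subst std_normal_pair.integral_fst)
      (auto simp: case_prod_unfold intro!: integrable_std_normal2_polynomial)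
  finally show ?thesis .
qed

section \<open>Moments of an indefinite quadratic form\<close>

text \<open>For \<open>X\<close>, \<open>Y\<close> of unit variance and correlation
  \<open>c\<close>, the sum and the difference have variances 2 (1 + c) and 2 (1 - c); at the
  standardised sum and difference this form is 2 X Y. The parameter is not confined to [-1, 1],
  because the induction on the exponents leaves that interval.\<close>

definition hyp_form :: "real \<Rightarrow> real \<times> real \<Rightarrow> real" where
  "hyp_form c z = (1 + c) * fst z ^ 2 - (1 - c) * snd z ^ 2"

text \<open>The numerator of the function \<open>h\<close> above, with the exponents themselves as
  arguments in place of their halves, and with any power \<open>n\<close>, since the recurrences
  lower \<open>n\<close> by one.\<close>

definition hyp_moment :: "real \<Rightarrow> nat \<Rightarrow> nat \<Rightarrow> nat \<Rightarrow> real" where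
  "hyp_moment c j l n = (LINT z|std_normal2. fst z ^ j * snd z ^ l * hyp_form c z ^ n)"

lemma real_polynomial_hyp_form [intro]: "real_polynomial_function (hyp_form c)"
  unfolding hyp_form_def by (intro real_polynomial_function_intros2)

lemma integrable_hyp_moment: "integrable std_normal2 (\<lambda>z. fst z ^ j * snd z ^ l * hyp_form c z ^ n)"
  by (intro integrable_std_normal2_polynomial real_polynomial_function_intros2 real_polynomial_hyp_form)

text \<open>Integration by parts in the first variable, one factor \<open>fst z\<close> being split
  off; the partial derivative of the form is 2 (1 + c) x. For \<open>n = 0\<close> the factor
  \<open>n\<close> cancels the term with the truncated exponent.\<close>

lemma hyp_moment_by_parts_fst:
  "hyp_moment c (j + 2) l n = (j + 1) * hyp_moment c j l n + 2 * n * (1 + c) * hyp_moment c (j + 2) l (n - 1)"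
proof -
  have "(LINT z|std_normal2. fst z * (fst z ^ (j + 1) * snd z ^ l * hyp_form c z ^ n))
     = (LINT z|std_normal2. (j + 1) * (fst z ^ j * snd z ^ l * hyp_form c z ^ n)
          + 2 * n * (1 + c) * (fst z ^ (j + 2) * snd z ^ l * hyp_form c z ^ (n - 1)))"
  proof (rule std_normal2_integral_fst_by_parts)
    show "((\<lambda>x. fst (x, y) ^ (j + 1) * snd (x, y) ^ l * hyp_form c (x, y) ^ n) has_real_derivative
        (j + 1) * (fst (x, y) ^ j * snd (x, y) ^ l * hyp_form c (x, y) ^ n)
          + 2 * n * (1 + c) * (fst (x, y) ^ (j + 2) * snd (x, y) ^ l * hyp_form c (x, y) ^ (n - 1))) (at x)" for x y
    proof -
      have "((\<lambda>x. hyp_form c (x, y)) has_real_derivative 2 * (1 + c) * x) (at x)"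
        unfolding hyp_form_def by (auto intro!: derivative_eq_intros)
      note D = DERIV_mult[OF DERIV_cmult_right[OF DERIV_power[OF DERIV_ident, of "j + 1"], of "y ^ l"] DERIV_power[OF this, of n]]
      show ?thesis unfolding fst_conv snd_conv by (rule DERIV_cong[OF D]) (simp add: algebra_simps)
    qed
  qed (intro real_polynomial_function_intros2 real_polynomial_hyp_form)+
  also have "\<dots> = (j + 1) * hyp_moment c j l n + 2 * n * (1 + c) * hyp_moment c (j + 2) l (n - 1)"
    unfolding hyp_moment_def
    by (simp only: Bochner_Integration.integral_add[OF integrable_mult_right integrable_mult_right]
        integrable_hyp_moment integral_mult_right_zero)
  finally show ?thesis by (simp add: hyp_moment_def mult.assoc)
qed

lemma hyp_moment_by_parts_snd:
  "hyp_moment c j (l + 2) n = (l + 1) * hyp_moment c j l n - 2 * n * (1 - c) * hyp_moment c j (l + 2) (n - 1)"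
proof -
  have "(LINT z|std_normal2. snd z * (fst z ^ j * snd z ^ (l + 1) * hyp_form c z ^ n))
     = (LINT z|std_normal2. (l + 1) * (fst z ^ j * snd z ^ l * hyp_form c z ^ n)
          - 2 * n * (1 - c) * (fst z ^ j * snd z ^ (l + 2) * hyp_form c z ^ (n - 1)))"
  proof (rule std_normal2_integral_snd_by_parts)
    show "((\<lambda>y. fst (x, y) ^ j * snd (x, y) ^ (l + 1) * hyp_form c (x, y) ^ n) has_real_derivative
        (l + 1) * (fst (x, y) ^ j * snd (x, y) ^ l * hyp_form c (x, y) ^ n)
          - 2 * n * (1 - c) * (fst (x, y) ^ j * snd (x, y) ^ (l + 2) * hyp_form c (x, y) ^ (n - 1))) (at y)" for x y
    proof -
      have "((\<lambda>y. hyp_form c (x, y)) has_real_derivative - (2 * (1 - c) * y)) (at y)"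
        unfolding hyp_form_def by (auto intro!: derivative_eq_intros)
      note D = DERIV_mult[OF DERIV_cmult[OF DERIV_power[OF DERIV_ident, of "l + 1"], of "x ^ j"] DERIV_power[OF this, of n]]
      show ?thesis unfolding fst_conv snd_conv by (rule DERIV_cong[OF D]) (simp add: algebra_simps)
    qed
  qed (intro real_polynomial_function_intros2 real_polynomial_hyp_form)+
  also have "\<dots> = (l + 1) * hyp_moment c j l n - 2 * n * (1 - c) * hyp_moment c j (l + 2) (n - 1)"
    unfolding hyp_moment_def
    by (simp only: Bochner_Integration.integral_diff[OF integrable_mult_right integrable_mult_right]
        integrable_hyp_moment integral_mult_right_zero)
  finally show ?thesis by (simp add: hyp_moment_def ac_simps)
qed

lemma hyp_moment_Suc:
  "hyp_moment c j l (Suc n) = (1 + c) * hyp_moment c (j + 2) l n - (1 - c) * hyp_moment c j (l + 2) n"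
proof -
  have "hyp_moment c j l (Suc n) = (LINT z|std_normal2. (1 + c) * (fst z ^ (j + 2) * snd z ^ l * hyp_form c z ^ n)
      - (1 - c) * (fst z ^ j * snd z ^ (l + 2) * hyp_form c z ^ n))"
    unfolding hyp_moment_def
    by (intro Bochner_Integration.integral_cong refl) (simp add: hyp_form_def power_add algebra_simps power2_eq_square)
  then show ?thesis unfolding hyp_moment_def
    by (simp only: Bochner_Integration.integral_diff[OF integrable_mult_right integrable_mult_right]
        integrable_hyp_moment integral_mult_right_zero)
qed

text \<open>The identity E[(a^2 + b^2) p] = (deg p + 2) E[p] for homogeneous \<open>p\<close>, here
  of degree \<open>j + l + 2 * n\<close>. The two integrations by parts add up, and
  \<open>hyp_moment_Suc\<close> recombines their remainders into the original moment.\<close>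

lemma hyp_moment_radial:
  "hyp_moment c (j + 2) l n + hyp_moment c j (l + 2) n = (j + l + 2 + 2 * n) * hyp_moment c j l n"
proof (cases n)
  case 0
  then show ?thesis
    using hyp_moment_by_parts_fst[of c j l n] hyp_moment_by_parts_snd[of c j l n] by (simp add: algebra_simps)
next
  case (Suc k)
  have "hyp_moment c (j + 2) l n + hyp_moment c j (l + 2) n = (j + l + 2) * hyp_moment c j l n
      + 2 * n * ((1 + c) * hyp_moment c (j + 2) l k - (1 - c) * hyp_moment c j (l + 2) k)"
    unfolding hyp_moment_by_parts_fst[of c j l n] hyp_moment_by_parts_snd[of c j l n]
    by (simp add: Suc algebra_simps)
  also have "\<dots> = (j + l + 2 + 2 * n) * hyp_moment c j l n"
    unfolding hyp_moment_Suc[symmetric] by (simp add: Suc algebra_simps)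
  finally show ?thesis by simp
qed

section \<open>Strict convexity in the parameter\<close>

lemma power_odd_strict_mono:
  fixes x y :: real
  assumes "odd n" "x < y"
  shows "x ^ n < y ^ n"
proof (rule ccontr)
  assume "\<not> x ^ n < y ^ n"
  moreover have "x ^ n \<le> y ^ n" using assms by (intro power_mono_odd) auto
  ultimately have "root n (x ^ n) = root n (y ^ n)" by simp
  then show False using assms by (simp add: odd_real_root_power_cancel)
qed

text \<open>Strict convexity of even powers: by the mean value theorem the secant slope is the
  derivative at an intermediate point, and the derivative, an odd power, is strictly
  increasing.\<close>

lemma power_even_gt_tangent:
  fixes x y :: real
  assumes "even n" "n > 0" "x \<noteq> y"
  shows "y ^ n > x ^ n + n * (y - x) * x ^ (n - 1)"
proof -
  have D: "((\<lambda>x. x ^ n) has_real_derivative n * z ^ (n - 1)) (at z)" for z :: real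
    by (auto intro!: derivative_eq_intros)
  have "odd (n - 1)" using assms by simp
  from assms consider "x < y" | "y < x" by linarith
  then show ?thesis
  proof cases
    case 1
    then obtain z :: real where z: "x < z" "z < y" "y ^ n - x ^ n = (y - x) * (n * z ^ (n - 1))"
      using MVT2[of x y "\<lambda>x. x ^ n" "\<lambda>z. n * z ^ (n - 1)"] D by auto
    have "n * (y - x) * x ^ (n - 1) < n * (y - x) * z ^ (n - 1)"
      using power_odd_strict_mono[OF \<open>odd (n - 1)\<close> z(1)] 1 assms by (intro mult_strict_left_mono) auto
    then show ?thesis using z(3) by (simp add: algebra_simps)
  next
    case 2
    then obtain z :: real where z: "y < z" "z < x" "x ^ n - y ^ n = (x - y) * (n * z ^ (n - 1))"
      using MVT2[of y x "\<lambda>x. x ^ n" "\<lambda>z. n * z ^ (n - 1)"] D by auto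
    have "n * (x - y) * z ^ (n - 1) < n * (x - y) * x ^ (n - 1)"
      using power_odd_strict_mono[OF \<open>odd (n - 1)\<close> z(2)] 2 assms by (intro mult_strict_left_mono) auto
    then show ?thesis using z(3) by (simp add: algebra_simps)
  qed
qed

lemma AE_std_normal_neq: "AE x in std_normal_distribution. x \<noteq> a"
proof -
  have "AE x in lborel. x \<noteq> a" by (rule AE_lborel_singleton)
  then show ?thesis by (subst AE_density) auto
qed

text \<open>Off the axes the even weights are positive, so the pointwise convexity estimate is
  strict almost everywhere.\<close>

lemma AE_std_normal2_nonzero: "AE z in std_normal2. fst z \<noteq> 0 \<and> snd z \<noteq> 0"
proof -
  have 1: "AE z in std_normal2. fst z \<noteq> 0"
  proof (rule AE_distrD[where f = fst and P = "\<lambda>x. x \<noteq> 0"])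
    show "AE x in distr std_normal2 std_normal_distribution fst. x \<noteq> 0"
      unfolding std_normal.distr_pair_fst by (rule AE_std_normal_neq)
  qed simp
  have 2: "AE z in std_normal2. fst (case z of (x, y) \<Rightarrow> (y, x)) \<noteq> 0"
  proof (rule AE_distrD[where f = "\<lambda>(x, y). (y, x)" and P = "\<lambda>z. fst z \<noteq> 0"])
    show "AE z in distr std_normal2 std_normal2 (\<lambda>(x, y). (y, x)). fst z \<noteq> 0"
      using 1 by (simp only: std_normal_pair.distr_pair_swap[symmetric])
  qed simp
  from 1 2 show ?thesis by eventually_elim auto
qed

lemma hyp_form_add: "hyp_form (c + d) z = hyp_form c z + d * (fst z ^ 2 + snd z ^ 2)"
  by (simp add: hyp_form_def algebra_simps)

text \<open>The strict tangent inequality in \<open>c\<close>, obtained by integrating the pointwise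
  one. The form is affine in \<open>c\<close> with slope a^2 + b^2, so
  \<open>hyp_moment_radial\<close> evaluates the derivative in closed form.\<close>

lemma hyp_moment_shift_gt:
  assumes jl: "even j" "even l" and n: "even n" "n > 0" and "d \<noteq> 0"
  shows "hyp_moment (c + d) j l n > hyp_moment c j l n + n * d * (j + l + 2 * n) * hyp_moment c j l (n - 1)"
proof -
  let ?w = "\<lambda>z::real \<times> real. fst z ^ j * snd z ^ l"
  let ?t = "\<lambda>z. ?w z * hyp_form c z ^ n + (n * d) * (fst z ^ (j + 2) * snd z ^ l * hyp_form c z ^ (n - 1)
        + fst z ^ j * snd z ^ (l + 2) * hyp_form c z ^ (n - 1))"
  have lt: "?t z < ?w z * hyp_form (c + d) z ^ n" if "fst z \<noteq> 0 \<and> snd z \<noteq> 0" for z :: "real \<times> real"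
  proof -
    have "fst z ^ 2 + snd z ^ 2 > 0" using that by (simp add: sum_power2_gt_zero_iff)
    then have "hyp_form c z \<noteq> hyp_form (c + d) z" using \<open>d \<noteq> 0\<close> unfolding hyp_form_add by (metis add_cancel_right_right less_irrefl mult_eq_0_iff)
    note power_even_gt_tangent[OF n this]
    moreover have "?w z > 0" using jl that
      by (auto intro!: mult_pos_pos simp: zero_less_power_eq)
    ultimately have "?w z * (hyp_form c z ^ n + n * (hyp_form (c + d) z - hyp_form c z) * hyp_form c z ^ (n - 1))
        < ?w z * hyp_form (c + d) z ^ n" by (rule mult_strict_left_mono)
    also have "?w z * (hyp_form c z ^ n + n * (hyp_form (c + d) z - hyp_form c z) * hyp_form c z ^ (n - 1)) = ?t z"
      by (simp add: hyp_form_add power_add power2_eq_square algebra_simps)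
    finally show ?thesis .
  qed
  have "hyp_moment c j l n + n * d * (hyp_moment c (j + 2) l (n - 1) + hyp_moment c j (l + 2) (n - 1))
      = (LINT z|std_normal2. ?t z)"
    unfolding hyp_moment_def by (simp add: integrable_hyp_moment del: power_Suc)
  also have "\<dots> < hyp_moment (c + d) j l n"
    unfolding hyp_moment_def
  proof (rule std_normal_pair.integral_less_AE_space)
    show "integrable std_normal2 ?t"
      by (intro Bochner_Integration.integrable_add integrable_mult_right integrable_hyp_moment)
    show "AE z in std_normal2. ?t z < ?w z * hyp_form (c + d) z ^ n"
      using AE_std_normal2_nonzero lt by auto
    show "emeasure std_normal2 (space std_normal2) \<noteq> 0"
      by (simp add: std_normal_pair.P.emeasure_space_1 del: space_pair_measure)
  qed (rule integrable_hyp_moment)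
  \<comment> \<open>With power \<open>n - 1\<close> the radial factor is j + l + 2 + 2 (n - 1) = j +
    l + 2 n.\<close>
  finally show ?thesis
    unfolding hyp_moment_radial using n by (simp add: algebra_simps of_nat_diff)
qed

section \<open>The minimal value, attained at zero correlation\<close>

abbreviation (input) hyp_bound :: "nat \<Rightarrow> real" where
  "hyp_bound m \<equiv> 4 ^ m * normal_moment (2 * m) ^ 2"

text \<open>Split off one factor a^2 - b^2 and integrate by parts in both variables: the leading
  terms cancel at \<open>c = 0\<close>, and the remainders form 2 n
  E[(a^2 + b^2) (a^2 - b^2)^(n - 1)], which the radial identity evaluates. At \<open>n = 0\<close>
  the right side is 0.\<close>

lemma hyp_moment_center:
  "hyp_moment 0 0 0 (Suc n) = 4 * n ^ 2 * hyp_moment 0 0 0 (n - 1)"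
proof (cases n)
  case 0
  then show ?thesis
    using hyp_moment_Suc[of 0 0 0 n] hyp_moment_by_parts_fst[of 0 0 0 0] hyp_moment_by_parts_snd[of 0 0 0 0] by simp
next
  case (Suc k)
  have "hyp_moment 0 0 0 (Suc n) = 2 * n * (hyp_moment 0 (0 + 2) 0 k + hyp_moment 0 0 (0 + 2) k)"
    unfolding hyp_moment_Suc hyp_moment_by_parts_fst[of 0 0 0 n] hyp_moment_by_parts_snd[of 0 0 0 n]
    by (simp add: Suc algebra_simps)
  also have "\<dots> = 4 * n ^ 2 * hyp_moment 0 0 0 (n - 1)"
    unfolding hyp_moment_radial by (simp add: Suc algebra_simps power2_eq_square)
  finally show ?thesis by simp
qed

lemma hyp_moment_center_odd: "odd n \<Longrightarrow> hyp_moment 0 0 0 n = 0"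
proof (induction n rule: nat_induct2)
  case 1 show ?case using hyp_moment_center[of 0] by simp
next
  case (step n) then show ?case using hyp_moment_center[of "Suc n"] by simp
qed simp

text \<open>Passing from \<open>m\<close> to \<open>m + 1\<close> multiplies both sides by 4 (2 m +
  1)^2. The value is the expected one, as a^2 - b^2 is twice the product of the independent standard
  normal variables (a + b) / sqrt 2 and (a - b) / sqrt 2.\<close>

lemma hyp_moment_center_even: "hyp_moment 0 0 0 (2 * m) = hyp_bound m"
proof (induction m)
  case 0
  then show ?case using std_normal_pair.P.prob_space std_normal.prob_space by (simp add: hyp_moment_def)
next
  case (Suc m)
  then show ?case
    using hyp_moment_center[of "Suc (2 * m)"] normal_moment_Suc_Suc[of "2 * m"]
    by (simp add: power_mult_distrib del: power_Suc) (simp add: algebra_simps power2_eq_square)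
qed

text \<open>The slope at 0 is a multiple of an odd central moment, hence 0, so strict convexity
  makes 0 the strict minimum.\<close>

lemma hyp_moment_00_gt: "m \<ge> 1 \<Longrightarrow> c \<noteq> 0 \<Longrightarrow> hyp_moment c 0 0 (2 * m) > hyp_bound m"
  using hyp_moment_shift_gt[of 0 0 "2 * m" c 0] hyp_moment_center_odd[of "2 * m - 1"] hyp_moment_center_even[of m]
  by simp

text \<open>The tangent at c' to the moment with exponent \<open>j + 2\<close>, evaluated at
  \<open>c = c' - k * (1 + c')\<close>, is exactly the right side by integration by parts.
  Strictness is recorded at \<open>c' = 0\<close>, the only parameter at which the lower moment can
  equal its bound.\<close>

lemma hyp_moment_step_fst:
  assumes "even j" "even l" "m \<ge> 1"
  shows "\<exists>c'. hyp_moment c (j + 2) l (2 * m) \<ge> (j + 1) * hyp_moment c' j l (2 * m) \<and>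
    (c' = 0 \<longrightarrow> hyp_moment c (j + 2) l (2 * m) > (j + 1) * hyp_moment c' j l (2 * m))"
proof -
  \<comment> \<open>Chosen so that \<open>k\<close> times the radial factor is 2, the constant in
    \<open>hyp_moment_by_parts_fst\<close>.\<close>
  define k where "k = 2 / (j + 2 + l + 4 * m :: real)"
  have k: "0 < k" "k < 1" "k * (j + 2 + l + 4 * m) = 2" 
    using assms unfolding k_def by (simp, simp, intro nonzero_eq_divide_eq[THEN iffD1]) auto
  \<comment> \<open>The solution of c' - k (1 + c') = c, which exists for every real
    \<open>c\<close> because \<open>k < 1\<close>; it can lie outside [-1, 1].\<close>
  define c' where "c' = (c + k) / (1 - k)"
  define d where "d = - k * (1 + c')"
  have "c' * (1 - k) = c + k" using k by (simp add: c'_def)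
  then have c: "c = c' + d" by (simp add: d_def algebra_simps)
  let ?H = "hyp_moment c' (j + 2) l"
  have "?H (2 * m) + 2 * m * d * (j + 2 + l + 4 * m) * ?H (2 * m - 1)
      = ?H (2 * m) - 2 * m * (1 + c') * (k * (j + 2 + l + 4 * m)) * ?H (2 * m - 1)"
    by (simp add: d_def algebra_simps)
  also have "\<dots> = (j + 1) * hyp_moment c' j l (2 * m)"
    unfolding k using hyp_moment_by_parts_fst[of c' j l "2 * m"] by (simp add: algebra_simps)
  finally have eq: "?H (2 * m) + 2 * m * d * (j + 2 + l + 4 * m) * ?H (2 * m - 1) = (j + 1) * hyp_moment c' j l (2 * m)" .
  show ?thesis
  proof (cases "d = 0")
    case True
    \<comment> \<open>Without a shift only equality holds, but then c' is not 0 and the strict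
      clause is vacuous.\<close>
    then have "c' = -1" using k unfolding d_def by simp
    then show ?thesis using eq True c by (intro exI[of _ c']) (auto simp: add.commute)
  next
    case False
    then have "hyp_moment c (j + 2) l (2 * m) > (j + 1) * hyp_moment c' j l (2 * m)"
      using hyp_moment_shift_gt[of "j + 2" l "2 * m" d c'] assms eq by (simp add: c ac_simps)
    then show ?thesis by (intro exI[of _ c']) (auto simp: add.commute)
  qed
qed

text \<open>Exchanging the variables turns \<open>hyp_form c\<close> into the negative of
  \<open>hyp_form (- c)\<close>, and an even power removes the sign. This transfers the step in the
  first exponent to the second.\<close>

lemma hyp_moment_swap: "even n \<Longrightarrow> hyp_moment c j l n = hyp_moment (- c) l j n"
proof -
  assume "even n"
  then have *: "hyp_form c z ^ n = hyp_form (- c) (snd z, fst z) ^ n" for z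
    by (subst power_minus_even[symmetric]) (simp_all add: hyp_form_def algebra_simps)
  have "hyp_moment c j l n = (LINT z|std_normal2. (\<lambda>z. fst z ^ l * snd z ^ j * hyp_form (- c) z ^ n) (snd z, fst z))"
    unfolding hyp_moment_def by (intro Bochner_Integration.integral_cong refl) (simp add: *)
  also have "\<dots> = hyp_moment (- c) l j n"
    unfolding hyp_moment_def
    using std_normal_pair.integral_product_swap[of "\<lambda>z. fst z ^ l * snd z ^ j * hyp_form (- c) z ^ n"] integrable_hyp_moment
    by (auto simp: case_prod_unfold)
  finally show ?thesis .
qed

text \<open>Induction with \<open>c\<close> arbitrary, since each step moves the parameter; the
  factor \<open>2 * j + 1\<close> gained is that of the normal moments.\<close>

lemma hyp_moment_fst_gt:
  assumes "m \<ge> 1" "j > 0 \<or> c \<noteq> 0"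
  shows "hyp_moment c (2 * j) 0 (2 * m) > hyp_bound m * normal_moment (2 * j)"
  using assms(2)
proof (induction j arbitrary: c)
  case 0
  then show ?case using hyp_moment_00_gt assms normal_moment_0 by simp
next
  case (Suc j)
  have "even (2 * j)" "even (0::nat)" by simp_all
  from hyp_moment_step_fst[OF this assms(1), of c]
  obtain c' where c': "hyp_moment c (2 * j + 2) 0 (2 * m) \<ge> (real (2 * j) + 1) * hyp_moment c' (2 * j) 0 (2 * m)"
    "c' = 0 \<Longrightarrow> hyp_moment c (2 * j + 2) 0 (2 * m) > (real (2 * j) + 1) * hyp_moment c' (2 * j) 0 (2 * m)"
    by blast
  have "(real (2 * j) + 1) * (hyp_bound m * normal_moment (2 * j)) < hyp_moment c (2 * j + 2) 0 (2 * m)"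
  \<comment> \<open>The induction hypothesis is strict except at \<open>j = 0\<close>,
    \<open>c' = 0\<close>; there the step itself is strict.\<close>
  proof (cases "j > 0 \<or> c' \<noteq> 0")
    case True
    have "real (2 * j) + 1 > 0" by simp
    then show ?thesis using order.strict_trans2[OF mult_strict_left_mono[OF Suc.IH[OF True]] c'(1)] by blast
  next
    case False
    then show ?thesis using c'(2) hyp_moment_center_even[of m] normal_moment_0 by simp
  qed
  then show ?case using normal_moment_Suc_Suc[of "2 * j"] by (simp add: algebra_simps)
qed

text \<open>The same induction on the second exponent, starting from
  \<open>hyp_moment_fst_gt\<close>, with the step carried over by
  \<open>hyp_moment_swap\<close>.\<close>

lemma hyp_moment_gt:
  assumes "m \<ge> 1" "j > 0 \<or> l > 0 \<or> c \<noteq> 0"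
  shows "hyp_moment c (2 * j) (2 * l) (2 * m) > hyp_bound m * normal_moment (2 * j) * normal_moment (2 * l)"
  using assms(2)
proof (induction l arbitrary: c)
  case 0
  then show ?case using hyp_moment_fst_gt assms normal_moment_0 by simp
next
  case (Suc l)
  have "even (2 * l)" "even (2 * j)" by simp_all
  from hyp_moment_step_fst[OF this assms(1), of "- c"]
  obtain c' where c': "hyp_moment (- c) (2 * l + 2) (2 * j) (2 * m) \<ge> (real (2 * l) + 1) * hyp_moment c' (2 * l) (2 * j) (2 * m)"
    "c' = 0 \<Longrightarrow> hyp_moment (- c) (2 * l + 2) (2 * j) (2 * m) > (real (2 * l) + 1) * hyp_moment c' (2 * l) (2 * j) (2 * m)"
    by blast
  have swap: "hyp_moment (- c) (2 * l + 2) (2 * j) (2 * m) = hyp_moment c (2 * j) (2 * l + 2) (2 * m)"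
    "hyp_moment c' (2 * l) (2 * j) (2 * m) = hyp_moment (- c') (2 * j) (2 * l) (2 * m)"
    using hyp_moment_swap[of "2 * m" "- c"] hyp_moment_swap[of "2 * m" c'] by auto
  have "(real (2 * l) + 1) * (hyp_bound m * normal_moment (2 * j) * normal_moment (2 * l)) < hyp_moment c (2 * j) (2 * l + 2) (2 * m)"
  proof (cases "j > 0 \<or> l > 0 \<or> c' \<noteq> 0")
    case True
    then have "j > 0 \<or> l > 0 \<or> - c' \<noteq> 0" by simp
    moreover have "real (2 * l) + 1 > 0" by simp
    ultimately show ?thesis
      using order.strict_trans2[OF mult_strict_left_mono[OF Suc.IH] c'(1)[unfolded swap]] by blast
  next
    case False
    then show ?thesis using c'(2) hyp_moment_center_even[of m] normal_moment_0 swap by simp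
  qed
  then show ?case using normal_moment_Suc_Suc[of "2 * l"] by (simp add: algebra_simps)
qed

lemma hyp_moment_ge:
  "m \<ge> 1 \<Longrightarrow> hyp_moment c (2 * j) (2 * l) (2 * m) \<ge> hyp_bound m * normal_moment (2 * j) * normal_moment (2 * l)"
  using hyp_moment_gt[of m j l c] hyp_moment_center_even[of m] normal_moment_0
  by (cases "j > 0 \<or> l > 0 \<or> c \<noteq> 0") auto

section \<open>Independence from characteristic functions\<close>

text \<open>Normalised to mean 1, \<open>h\<close> is a probability density. Under the reweighted
  measure \<open>Y\<close> has the same characteristic function as under \<open>M\<close>, hence the
  same law by Levy's uniqueness theorem.\<close>

lemma (in prob_space) weighted_prob_of_char_factor:
  fixes h :: "'a \<Rightarrow> real"
  assumes [measurable]: "h \<in> borel_measurable M" "Y \<in> borel_measurable M"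
    and pos: "\<And>x. h x > 0" and bound: "\<And>x. h x \<le> C"
    and char: "\<And>t. expectation (\<lambda>x. h x * iexp (t * Y x)) = expectation h * expectation (\<lambda>x. iexp (t * Y x))"
    and [measurable]: "B \<in> sets borel"
  shows "expectation (\<lambda>x. h x * indicator B (Y x)) = expectation h * prob (Y -` B \<inter> space M)"
proof -
  have h_int: "integrable M h"
    using pos bound by (intro integrable_const_bound[of _ C]) (auto intro!: AE_I2 simp: less_imp_le)
  have "expectation h > 0"
    using integral_less_AE_space[OF integrable_zero h_int] pos emeasure_space_1 by simp
  define w where "w = (\<lambda>x. h x / expectation h)"
  have [measurable]: "w \<in> borel_measurable M" unfolding w_def by measurable
  have w_nonneg: "w x \<ge> 0" for x using pos[of x] \<open>expectation h > 0\<close> by (simp add: w_def)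
  let ?N = "density M w"
  have "emeasure ?N (space ?N) = (\<integral>\<^sup>+x. ennreal (w x) \<partial>M)"
    by (subst emeasure_density) (auto intro!: nn_integral_cong)
  also have "\<dots> = ennreal (expectation w)"
    using h_int w_nonneg unfolding w_def by (intro nn_integral_eq_integral) auto
  also have "expectation w = 1" using \<open>expectation h > 0\<close> unfolding w_def by simp
  finally have "prob_space ?N" by (intro prob_spaceI) simp
  have "real_distribution (distr ?N borel Y)"
    by (intro prob_space.real_distribution_distr \<open>prob_space ?N\<close>) simp
  moreover have "real_distribution (distr M borel Y)"
    by (intro real_distribution_distr) simp
  moreover have "char (distr ?N borel Y) t = char (distr M borel Y) t" for t
  proof -
    have "char (distr ?N borel Y) t = (CLINT x|?N. iexp (t * Y x))"
      unfolding char_def by (subst integral_distr) simp_all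
    also have "\<dots> = (CLINT x|M. w x *\<^sub>R iexp (t * Y x))"
      using w_nonneg by (subst integral_density) auto
    also have "\<dots> = (CLINT x|M. (h x * iexp (t * Y x)) / expectation h)"
      by (intro Bochner_Integration.integral_cong refl) (simp add: w_def scaleR_conv_of_real)
    also have "\<dots> = (CLINT x|M. iexp (t * Y x))"
      using \<open>expectation h > 0\<close> by (subst Bochner_Integration.integral_divide_zero) (simp add: char del: of_real_mult)
    also have "\<dots> = char (distr M borel Y) t"
      unfolding char_def by (subst integral_distr) simp_all
    finally show ?thesis .
  qed
  ultimately have "distr ?N borel Y = distr M borel Y"
    by (intro Levy_uniqueness ext)
  then have "measure (distr ?N borel Y) B = measure (distr M borel Y) B" by simp
  then have eq: "measure ?N (Y -` B \<inter> space M) = prob (Y -` B \<inter> space M)"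
    by (simp add: measure_distr)
  have "measure ?N (Y -` B \<inter> space M) = (LINT x|?N. indicator (Y -` B \<inter> space M) x)"
    by simp
  also have "\<dots> = (LINT x|?N. indicator B (Y x))"
    by (intro Bochner_Integration.integral_cong) (auto simp: indicator_def)
  also have "\<dots> = (LINT x|M. w x *\<^sub>R indicator B (Y x))"
    using w_nonneg by (subst integral_density) auto
  also have "\<dots> = expectation (\<lambda>x. h x * indicator B (Y x)) / expectation h"
    by (simp add: w_def)
  finally show ?thesis
    using eq \<open>expectation h > 0\<close> by (simp add: field_simps)
qed

text \<open>Adding \<open>C + 1\<close> makes the real part a positive bounded weight; the
  contribution of the constant factorises trivially and is subtracted again.\<close>

lemma (in prob_space) Re_weighted_prob_of_char_factor:
  fixes g :: "'a \<Rightarrow> complex"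
  assumes [measurable]: "g \<in> borel_measurable M" "Y \<in> borel_measurable M"
    and bound: "\<And>x. cmod (g x) \<le> C"
    and char: "\<And>t. expectation (\<lambda>x. g x * iexp (t * Y x)) = expectation g * expectation (\<lambda>x. iexp (t * Y x))"
    and [measurable]: "B \<in> sets borel"
  shows "expectation (\<lambda>x. Re (g x) * indicator B (Y x)) = Re (expectation g) * prob (Y -` B \<inter> space M)"
proof -
  have g_int: "integrable M g"
    using bound by (intro integrable_const_bound[of _ C]) (auto intro!: AE_I2)
  have int_1: "integrable M (\<lambda>x. iexp (t * Y x))" for t
    by (intro integrable_const_bound[of _ 1]) (auto intro!: AE_I2)
  have int_g: "integrable M (\<lambda>x. g x * iexp (t * Y x))" for t
    using bound by (intro integrable_const_bound[of _ C]) (auto intro!: AE_I2 simp: norm_mult)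
  have Re_bound: "\<bar>Re (g x)\<bar> \<le> C" for x
    using abs_Re_le_cmod[of "g x"] bound[of x] by linarith
  define h where "h = (\<lambda>x. C + 1 + Re (g x))"
  have [measurable]: "h \<in> borel_measurable M" unfolding h_def by measurable
  have Eh: "expectation h = C + 1 + Re (expectation g)"
    unfolding h_def using g_int by (simp add: prob_space)
  have h_char: "expectation (\<lambda>x. h x * iexp (t * Y x)) = expectation h * expectation (\<lambda>x. iexp (t * Y x))" for t
  proof -
    let ?e = "expectation (\<lambda>x. iexp (t * Y x))"
    \<comment> \<open>Conjugating the hypothesis at \<open>- t\<close> gives it for
      \<open>cnj g\<close>, and thus for the real part.\<close>
    have cnj_char: "expectation (\<lambda>x. cnj (g x) * iexp (t * Y x)) = cnj (expectation g) * ?e"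
    proof -
      have "expectation (\<lambda>x. cnj (g x) * iexp (t * Y x)) = expectation (\<lambda>x. cnj (g x * iexp (- t * Y x)))"
        by (simp add: exp_cnj)
      also have "\<dots> = cnj (expectation (\<lambda>x. g x * iexp (- t * Y x)))" by (rule Bochner_Integration.integral_cnj)
      also have "\<dots> = cnj (expectation g) * cnj (expectation (\<lambda>x. iexp (- t * Y x)))"
        unfolding char by simp
      also have "cnj (expectation (\<lambda>x. iexp (- t * Y x))) = expectation (\<lambda>x. cnj (iexp (- t * Y x)))"
        by (rule Bochner_Integration.integral_cnj[symmetric])
      also have "\<dots> = ?e" by (simp add: exp_cnj)
      finally show ?thesis .
    qed
    have int_cnj: "integrable M (\<lambda>x. cnj (g x) * iexp (t * Y x))"
      using integrable_cnj[OF int_g[of "- t"]] by (simp add: exp_cnj)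
    have "expectation (\<lambda>x. h x * iexp (t * Y x)) = expectation (\<lambda>x. (C + 1) * iexp (t * Y x)
        + (1 / 2 * (g x * iexp (t * Y x)) + 1 / 2 * (cnj (g x) * iexp (t * Y x))))"
    proof (intro Bochner_Integration.integral_cong refl)
      fix x
      have "complex_of_real (Re (g x)) = (g x + cnj (g x)) / 2" by (simp add: complex_add_cnj)
      then show "h x * iexp (t * Y x) = (C + 1) * iexp (t * Y x)
        + (1 / 2 * (g x * iexp (t * Y x)) + 1 / 2 * (cnj (g x) * iexp (t * Y x)))"
        by (simp add: h_def algebra_simps add_divide_distrib)
    qed
    also have "\<dots> = (C + 1) * ?e + (1 / 2 * (expectation g * ?e) + 1 / 2 * (cnj (expectation g) * ?e))"
      using int_cnj int_1[of t] int_g[of t] by (simp add: char cnj_char del: of_real_mult)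
    also have "\<dots> = ((C + 1) + (expectation g + cnj (expectation g)) / 2) * ?e"
      by (simp add: algebra_simps add_divide_distrib)
    also have "\<dots> = expectation h * ?e"
      unfolding complex_add_cnj Eh by simp
    finally show ?thesis .
  qed
  have h_pos: "h x > 0" and h_le: "h x \<le> 2 * C + 1" for x
    using Re_bound[of x] by (auto simp: h_def)
  have "expectation (\<lambda>x. h x * indicator B (Y x)) = expectation h * prob (Y -` B \<inter> space M)"
    by (rule weighted_prob_of_char_factor[OF _ _ h_pos h_le h_char]) measurable
  moreover have "expectation (\<lambda>x. h x * indicator B (Y x))
      = (C + 1) * prob (Y -` B \<inter> space M) + expectation (\<lambda>x. Re (g x) * indicator B (Y x))"
  proof -
    have "integrable M (\<lambda>x. Re (g x) * indicator B (Y x))"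
      using Re_bound order_trans[OF abs_ge_zero Re_bound]
      by (intro integrable_const_bound[of _ C]) (auto intro!: AE_I2 simp: indicator_def)
    moreover have "integrable M (\<lambda>x. indicator B (Y x) :: real)"
      by (intro integrable_const_bound[of _ 1]) (auto intro!: AE_I2 simp: indicator_def)
    moreover have "expectation (\<lambda>x. indicator B (Y x)) = prob (Y -` B \<inter> space M)"
    proof -
      have "expectation (\<lambda>x. indicat_real B (Y x)) = expectation (indicator (Y -` B \<inter> space M))"
        by (intro Bochner_Integration.integral_cong) (auto simp: indicator_def)
      then show ?thesis by simp
    qed
    ultimately show ?thesis unfolding h_def by (simp add: distrib_right)
  qed
  ultimately show ?thesis by (simp add: Eh algebra_simps)
qed

lemma (in prob_space) complex_weighted_prob_of_char_factor:
  fixes g :: "'a \<Rightarrow> complex"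
  assumes [measurable]: "g \<in> borel_measurable M" "Y \<in> borel_measurable M"
    and bound: "\<And>x. cmod (g x) \<le> C"
    and char: "\<And>t. expectation (\<lambda>x. g x * iexp (t * Y x)) = expectation g * expectation (\<lambda>x. iexp (t * Y x))"
    and [measurable]: "B \<in> sets borel"
  shows "expectation (\<lambda>x. g x * indicator B (Y x)) = expectation g * prob (Y -` B \<inter> space M)"
proof -
  have int: "integrable M (\<lambda>x. g x * indicator B (Y x))"
    using bound order_trans[OF norm_ge_zero bound]
    by (intro integrable_const_bound[of _ C]) (auto intro!: AE_I2 simp: indicator_def)
  have Re_eq: "Re (z * indicator B y) = Re z * indicator B y" and Im_eq: "Im (z * indicator B y) = Re (- \<i> * z) * indicator B y" for z y
    by (auto simp: indicator_def)
  have "Re (expectation (\<lambda>x. g x * indicator B (Y x))) = Re (expectation g) * prob (Y -` B \<inter> space M)"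
    unfolding integral_Re[OF int, symmetric] Re_eq
    by (rule Re_weighted_prob_of_char_factor[OF _ _ bound char]) measurable
  moreover have "Im (expectation (\<lambda>x. g x * indicator B (Y x))) = Re (expectation (\<lambda>x. - \<i> * g x)) * prob (Y -` B \<inter> space M)"
    unfolding integral_Im[OF int, symmetric] Im_eq
    using bound by (intro Re_weighted_prob_of_char_factor[of _ _ C]) (auto simp: char norm_mult mult.assoc simp del: of_real_mult)
  ultimately show ?thesis by (simp add: complex_eq_iff)
qed

text \<open>Kac's theorem. The exponentials are replaced by indicators one variable at a time; once
  all are replaced, the product formula on Borel rectangles remains.\<close>

lemma (in prob_space) indep_vars_of_char_factor:
  fixes X :: "'i \<Rightarrow> 'a \<Rightarrow> real"
  assumes I: "finite I" "I \<noteq> {}" and X: "\<And>i. i \<in> I \<Longrightarrow> X i \<in> borel_measurable M"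
    and char: "\<And>t. expectation (\<lambda>x. \<Prod>i\<in>I. iexp (t i * X i x)) = (\<Prod>i\<in>I. expectation (\<lambda>x. iexp (t i * X i x)))"
  shows "indep_vars (\<lambda>_. borel) X I"
proof -
  have factor: "expectation (\<lambda>x. (\<Prod>i\<in>J. indicator (B i) (X i x)) * (\<Prod>i\<in>I - J. iexp (t i * X i x)))
      = (\<Prod>i\<in>J. prob (X i -` B i \<inter> space M)) * (\<Prod>i\<in>I - J. expectation (\<lambda>x. iexp (t i * X i x)))"
    if "J \<subseteq> I" "\<And>i. i \<in> J \<Longrightarrow> B i \<in> sets borel" for J B t
  proof -
    have "finite J" using that(1) I finite_subset by auto
    then show ?thesis using that
    proof (induction J arbitrary: t rule: finite_induct)
      case empty
      then show ?case using char by simp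
    next
      case (insert k J)
      define R where "R = I - insert k J"
      have R: "I - J = insert k R" "finite R" "k \<notin> R" "R \<subseteq> I" "k \<in> I" "J \<subseteq> I"
        using insert.prems insert.hyps I by (auto simp: R_def)
      define g :: "'a \<Rightarrow> complex" where "g = (\<lambda>x. (\<Prod>i\<in>J. indicator (B i) (X i x)) * (\<Prod>i\<in>R. iexp (t i * X i x)))"
      let ?c = "(\<Prod>i\<in>J. prob (X i -` B i \<inter> space M)) * (\<Prod>i\<in>R. expectation (\<lambda>x. iexp (t i * X i x)))"
      note [measurable] = X[OF R(5)]
      have [measurable]: "B i \<in> sets borel" if "i \<in> insert k J" for i using insert.prems(2) that by auto
      have [measurable]: "X i \<in> borel_measurable M" if "i \<in> J \<union> R" for i using R that X by auto
      have g_meas: "g \<in> borel_measurable M"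
        unfolding g_def by (intro borel_measurable_times borel_measurable_prod) measurable
      \<comment> \<open>The induction hypothesis holds for every \<open>t\<close>, so the entry at
        \<open>k\<close> may be overwritten by any \<open>s\<close>; \<open>s = 0\<close> then gives
        the mean of \<open>g\<close>.\<close>
      have g_char: "expectation (\<lambda>x. g x * iexp (s * X k x)) = ?c * expectation (\<lambda>x. iexp (s * X k x))" for s
      proof -
        have "expectation (\<lambda>x. g x * iexp (s * X k x))
            = expectation (\<lambda>x. (\<Prod>i\<in>J. indicator (B i) (X i x)) * (\<Prod>i\<in>I - J. iexp ((t(k := s)) i * X i x)))"
          using R(2,3) by (intro Bochner_Integration.integral_cong refl) (auto simp: g_def R(1) intro!: prod.cong)
        also have "\<dots> = (\<Prod>i\<in>J. prob (X i -` B i \<inter> space M)) * (\<Prod>i\<in>I - J. expectation (\<lambda>x. iexp ((t(k := s)) i * X i x)))"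
          using insert.IH[of "t(k := s)"] insert.prems(2) R(6) by blast
        also have "\<dots> = ?c * expectation (\<lambda>x. iexp (s * X k x))"
          using R(2,3) by (auto simp: R(1) intro!: prod.cong)
        finally show ?thesis .
      qed
      have Eg: "expectation g = ?c" using g_char[of 0] prob_space by simp
      have "cmod (g x) \<le> 1" for x
      proof -
        have "cmod (g x) = (\<Prod>i\<in>J. cmod (indicator (B i) (X i x)))"
          by (simp add: g_def norm_mult prod_norm[symmetric])
        also have "\<dots> \<le> 1" by (intro prod_le_1) (auto simp: indicator_def)
        finally show ?thesis .
      qed
      then have g_ind: "expectation (\<lambda>x. g x * indicator (B k) (X k x)) = expectation g * prob (X k -` B k \<inter> space M)"
        by (intro complex_weighted_prob_of_char_factor[of _ _ 1]) (simp_all add: g_char Eg g_meas del: of_real_mult)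
      have "expectation (\<lambda>x. (\<Prod>i\<in>insert k J. indicator (B i) (X i x)) * (\<Prod>i\<in>I - insert k J. iexp (t i * X i x)))
          = expectation (\<lambda>x. g x * indicator (B k) (X k x))"
        using insert.hyps by (simp add: g_def R_def ac_simps)
      also have "\<dots> = ?c * prob (X k -` B k \<inter> space M)" unfolding g_ind Eg ..
      also have "\<dots> = (\<Prod>i\<in>insert k J. prob (X i -` B i \<inter> space M)) * (\<Prod>i\<in>I - insert k J. expectation (\<lambda>x. iexp (t i * X i x)))"
        using insert.hyps by (simp add: R_def ac_simps)
      finally show ?case .
    qed
  qed
  have "prob (\<Inter>j\<in>I. X j -` B j \<inter> space M) = (\<Prod>j\<in>I. prob (X j -` B j \<inter> space M))"
    if "\<And>i. i \<in> I \<Longrightarrow> B i \<in> sets borel" for B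
  proof -
    let ?A = "\<Inter>j\<in>I. X j -` B j \<inter> space M"
    have A: "?A \<in> events"
      using I measurable_sets[OF X that] by (intro sets.finite_INT) auto
    then have "complex_of_real (prob ?A) = expectation (\<lambda>x. complex_of_real (indicator ?A x))"
      using sets.sets_into_space[OF A] by (simp only: integral_complex_of_real Bochner_Integration.integral_indicator Int_absorb2)
    also have "\<dots> = expectation (\<lambda>x. (\<Prod>i\<in>I. indicator (B i) (X i x)))"
    proof (intro Bochner_Integration.integral_cong refl)
      fix x assume x: "x \<in> space M"
      show "complex_of_real (indicator ?A x) = (\<Prod>i\<in>I. indicator (B i) (X i x))"
      proof (cases "x \<in> ?A")
        case True
        then have "\<forall>i\<in>I. X i x \<in> B i" by blast
        then have "(\<Prod>i\<in>I. indicator (B i) (X i x)) = (1::complex)" by (intro prod.neutral) simp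
        then show ?thesis using True by simp
      next
        case False
        then obtain i where "i \<in> I" "X i x \<notin> B i" using I(2) x by auto
        then have "(\<Prod>i\<in>I. indicator (B i) (X i x)) = (0::complex)" using I(1) by (intro prod_zero bexI[of _ i]) auto
        then show ?thesis using False by simp
      qed
    qed
    also have "\<dots> = (\<Prod>j\<in>I. prob (X j -` B j \<inter> space M))"
      using factor[of I B] that by simp
    finally show ?thesis by (simp only: of_real_eq_iff flip: of_real_prod)
  qed
  then show ?thesis
    using I X by (subst indep_vars_finite[where E = "\<lambda>_. sets borel"])
      (auto simp: Int_stable_def sets.sigma_sets_eq[of borel, simplified] Pi_iff)
qed

section \<open>Centered Gaussian vectors\<close>

lemma real_polynomial_function_inner: "real_polynomial_function (\<lambda>x::'b::real_inner. u \<bullet> x)"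
  by (intro real_polynomial_function.intros(1) bounded_linear_inner_right)

lemma integrable_of_basis:
  fixes V :: "'a \<Rightarrow> 'b::euclidean_space"
  assumes "\<And>b. b \<in> Basis \<Longrightarrow> integrable M (\<lambda>\<omega>. b \<bullet> V \<omega>)"
  shows "integrable M V"
proof -
  have "integrable M (\<lambda>\<omega>. \<Sum>b\<in>Basis. (b \<bullet> V \<omega>) *\<^sub>R b)"
    using assms by (intro Bochner_Integration.integrable_sum integrable_scaleR_left) auto
  moreover have "(\<Sum>b\<in>Basis. (b \<bullet> x) *\<^sub>R b) = x" for x :: 'b
    unfolding inner_commute[of _ x] by (rule euclidean_representation)
  ultimately show ?thesis by simp
qed

lemma (in prob_space) integrable_gaussian_var:
  assumes "gaussian_var M X"
  shows "integrable M X"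
proof -
  note assms[unfolded gaussian_var_def]
  then consider \<mu> where "AE \<omega> in M. X \<omega> = \<mu>" | \<mu> \<sigma> where "\<sigma> > 0" "distributed M lborel X (normal_density \<mu> \<sigma>)"
    by blast
  then show ?thesis
  proof cases
    case 1
    then have "integrable M X \<longleftrightarrow> integrable M (\<lambda>_. \<mu>)"
      using assms by (intro integrable_cong_AE) (auto simp: gaussian_var_def)
    then show ?thesis by simp
  next
    case 2
    then show ?thesis
      using distributed_integrable[of M lborel X "normal_density \<mu> \<sigma>" "\<lambda>x. x"] integrable_normal_moment_nz_1[of \<sigma> \<mu>]
      by simp
  qed
qed

text \<open>Allowing \<open>\<sigma> = 0\<close> treats point masses and nondegenerate normal laws
  alike, so singular covariances need no separate treatment later.\<close>

lemma (in prob_space) centered_gaussian_projection: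
  fixes V :: "'a \<Rightarrow> 'b::euclidean_space"
  assumes V: "centered_gaussian_vector M V"
  obtains \<sigma> where "\<sigma> \<ge> 0" "distr M borel (\<lambda>\<omega>. u \<bullet> V \<omega>) = distr std_normal_distribution borel (\<lambda>x. \<sigma> * x)"
proof -
  have gv: "gaussian_var M (\<lambda>\<omega>. v \<bullet> V \<omega>)" for v
    using V by (simp add: centered_gaussian_vector_def gaussian_vector_def)
  \<comment> \<open>Needed to move the inner product through the expectation: for a non-integrable
    \<open>V\<close> the integral would be 0 by convention.\<close>
  have "integrable M V" by (rule integrable_of_basis) (rule integrable_gaussian_var[OF gv])
  then have "expectation (\<lambda>\<omega>. u \<bullet> V \<omega>) = u \<bullet> expectation V" by simp
  then have mean: "expectation (\<lambda>\<omega>. u \<bullet> V \<omega>) = 0"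
    using V by (simp add: centered_gaussian_vector_def)
  have [measurable]: "(\<lambda>\<omega>. u \<bullet> V \<omega>) \<in> borel_measurable M" using gv by (simp add: gaussian_var_def)
  note gv[of u, unfolded gaussian_var_def]
  then consider \<mu> where "AE \<omega> in M. u \<bullet> V \<omega> = \<mu>" | \<mu> \<sigma> where "\<sigma> > 0" "distributed M lborel (\<lambda>\<omega>. u \<bullet> V \<omega>) (normal_density \<mu> \<sigma>)"
    by blast
  then show thesis
  proof cases
    case 1
    then have "expectation (\<lambda>\<omega>. u \<bullet> V \<omega>) = expectation (\<lambda>_. \<mu>)"
      by (intro integral_cong_AE) auto
    then have "\<mu> = 0" using mean by (simp add: prob_space)
    then have "distr M borel (\<lambda>\<omega>. u \<bullet> V \<omega>) = distr M borel (\<lambda>_. 0)"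
      using 1 by (intro distr_cong_AE) auto
    also have "\<dots> = return borel 0" by (rule distr_const) simp
    also have "\<dots> = distr std_normal_distribution borel (\<lambda>x. 0 * x)"
      using std_normal.distr_const[of 0 borel] by simp
    finally show thesis by (intro that[of 0]) auto
  next
    case 2
    then have "\<mu> = 0" using normal_distributed_expectation[of \<sigma> "\<lambda>\<omega>. u \<bullet> V \<omega>" \<mu>] mean by simp
    then have "distributed M lborel (\<lambda>\<omega>. (u \<bullet> V \<omega>) / \<sigma>) std_normal_density"
      using 2 normal_standard_normal_convert[of \<sigma> "\<lambda>\<omega>. u \<bullet> V \<omega>" \<mu>] by simp
    then have "distr M lborel (\<lambda>\<omega>. (u \<bullet> V \<omega>) / \<sigma>) = std_normal_distribution"
      by (simp add: distributed_def)
    then have "distr std_normal_distribution borel (\<lambda>x. \<sigma> * x) = distr (distr M lborel (\<lambda>\<omega>. (u \<bullet> V \<omega>) / \<sigma>)) borel (\<lambda>x. \<sigma> * x)"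
      by simp
    also have "\<dots> = distr M borel (\<lambda>\<omega>. u \<bullet> V \<omega>)"
      using 2 by (subst distr_distr) (auto simp: o_def)
    finally show thesis using 2 by (intro that[of \<sigma>]) auto
  qed
qed

section \<open>Moments and independence of the projections of a centered Gaussian vector\<close>

context prob_space
begin

context
  fixes V :: "'a \<Rightarrow> 'b::euclidean_space"
  assumes V: "centered_gaussian_vector M V"
begin

lemma centered_gaussian_measurable [measurable]: "V \<in> borel_measurable M"
  using V by (simp add: centered_gaussian_vector_def gaussian_vector_def)

lemma centered_gaussian_integrable_moment: "integrable M (\<lambda>\<omega>. (u \<bullet> V \<omega>) ^ n)"
proof -
  obtain \<sigma> where s: "distr M borel (\<lambda>\<omega>. u \<bullet> V \<omega>) = distr std_normal_distribution borel (\<lambda>x. \<sigma> * x)"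
    using centered_gaussian_projection[OF V] by blast
  have "integrable (distr std_normal_distribution borel (\<lambda>x. \<sigma> * x)) (\<lambda>y. y ^ n)"
    by (subst integrable_distr_eq) (auto simp: power_mult_distrib intro!: integrable_mult_right integrable_std_normal_distribution_moment)
  then show ?thesis unfolding s[symmetric] by (subst (asm) integrable_distr_eq) auto
qed

lemma centered_gaussian_moment:
  "expectation (\<lambda>\<omega>. (u \<bullet> V \<omega>) ^ n) = sqrt (expectation (\<lambda>\<omega>. (u \<bullet> V \<omega>) ^ 2)) ^ n * normal_moment n"
proof -
  obtain \<sigma> where s: "\<sigma> \<ge> 0" "distr M borel (\<lambda>\<omega>. u \<bullet> V \<omega>) = distr std_normal_distribution borel (\<lambda>x. \<sigma> * x)"
    using centered_gaussian_projection[OF V] by blast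
  have E: "expectation (\<lambda>\<omega>. (u \<bullet> V \<omega>) ^ n) = \<sigma> ^ n * normal_moment n" for n
  proof -
    have "expectation (\<lambda>\<omega>. (u \<bullet> V \<omega>) ^ n) = (LINT y|distr M borel (\<lambda>\<omega>. u \<bullet> V \<omega>). y ^ n)"
      by (subst integral_distr) auto
    also have "\<dots> = \<sigma> ^ n * normal_moment n"
      unfolding s(2) by (subst integral_distr) (auto simp: power_mult_distrib)
    finally show ?thesis .
  qed
  show ?thesis unfolding E using s(1) by (simp add: normal_moment_2)
qed

lemma centered_gaussian_char:
  "expectation (\<lambda>\<omega>. iexp (u \<bullet> V \<omega>)) = exp (- (expectation (\<lambda>\<omega>. (u \<bullet> V \<omega>) ^ 2) / 2))"
proof -
  obtain \<sigma> where s: "\<sigma> \<ge> 0" "distr M borel (\<lambda>\<omega>. u \<bullet> V \<omega>) = distr std_normal_distribution borel (\<lambda>x. \<sigma> * x)"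
    using centered_gaussian_projection[OF V] by blast
  have E: "expectation (\<lambda>\<omega>. (u \<bullet> V \<omega>) ^ 2) = \<sigma> ^ 2"
  proof -
    have "expectation (\<lambda>\<omega>. (u \<bullet> V \<omega>) ^ 2) = (LINT y|distr M borel (\<lambda>\<omega>. u \<bullet> V \<omega>). y ^ 2)"
      by (subst integral_distr) auto
    also have "\<dots> = \<sigma> ^ 2 * normal_moment 2"
      unfolding s(2) by (subst integral_distr) (auto simp: power_mult_distrib)
    finally show ?thesis by (simp add: normal_moment_2)
  qed
  have "expectation (\<lambda>\<omega>. iexp (u \<bullet> V \<omega>)) = (CLINT y|distr M borel (\<lambda>\<omega>. u \<bullet> V \<omega>). iexp y)"
    by (subst integral_distr) auto
  also have "\<dots> = (CLINT x|std_normal_distribution. iexp (\<sigma> * x))"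
    unfolding s(2) by (subst integral_distr) auto
  also have "\<dots> = char std_normal_distribution \<sigma>" by (simp add: char_def)
  also have "\<dots> = exp (- (\<sigma> ^ 2 / 2))" by (simp add: char_std_normal_distribution)
  finally show ?thesis unfolding E .
qed

lemma centered_gaussian_integrable_polynomial:
  assumes "real_polynomial_function p"
  shows "integrable M (\<lambda>\<omega>. p (V \<omega>))"
proof (rule integrable_real_polynomial_function[OF assms])
  show "integrable M (\<lambda>\<omega>. (V \<omega> \<bullet> b) ^ n)" for b n
    unfolding inner_commute[of _ b] by (rule centered_gaussian_integrable_moment)
qed simp

lemma centered_gaussian_integrable_mult: "integrable M (\<lambda>\<omega>. (u \<bullet> V \<omega>) * (v \<bullet> V \<omega>))"
  by (intro centered_gaussian_integrable_polynomial[of "\<lambda>x. (u \<bullet> x) * (v \<bullet> x)"] real_polynomial_function.intros(4)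
      real_polynomial_function_inner)

text \<open>The variance of a linear combination has no cross terms, so the joint characteristic
  function is a product and Kac's theorem applies, degenerate projections included.\<close>

lemma centered_gaussian_indep_vars:
  fixes u :: "'i \<Rightarrow> 'b"
  assumes I: "finite I" "I \<noteq> {}"
    and uncorrelated: "\<And>i j. i \<in> I \<Longrightarrow> j \<in> I \<Longrightarrow> i \<noteq> j \<Longrightarrow> expectation (\<lambda>\<omega>. (u i \<bullet> V \<omega>) * (u j \<bullet> V \<omega>)) = 0"
  shows "indep_vars (\<lambda>_. borel) (\<lambda>i \<omega>. u i \<bullet> V \<omega>) I"
proof (rule indep_vars_of_char_factor[OF I])
  fix t :: "'i \<Rightarrow> real"
  let ?v = "\<lambda>i. expectation (\<lambda>\<omega>. (u i \<bullet> V \<omega>) ^ 2)"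
  define w where "w = (\<Sum>i\<in>I. t i *\<^sub>R u i)"
  have "expectation (\<lambda>\<omega>. (w \<bullet> V \<omega>) ^ 2)
      = expectation (\<lambda>\<omega>. \<Sum>i\<in>I. \<Sum>j\<in>I. t i * t j * ((u i \<bullet> V \<omega>) * (u j \<bullet> V \<omega>)))"
    by (simp add: w_def inner_sum_left power2_eq_square sum_product ac_simps)
  also have "\<dots> = (\<Sum>i\<in>I. \<Sum>j\<in>I. t i * t j * expectation (\<lambda>\<omega>. (u i \<bullet> V \<omega>) * (u j \<bullet> V \<omega>)))"
    by (simp add: centered_gaussian_integrable_mult)
  also have "\<dots> = (\<Sum>i\<in>I. \<Sum>j\<in>I. if j = i then t i ^ 2 * ?v i else 0)"
    by (intro sum.cong refl) (auto simp: uncorrelated power2_eq_square)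
  also have "\<dots> = (\<Sum>i\<in>I. t i ^ 2 * ?v i)" using I by simp
  finally have var: "expectation (\<lambda>\<omega>. (w \<bullet> V \<omega>) ^ 2) = (\<Sum>i\<in>I. t i ^ 2 * ?v i)" .
  have "expectation (\<lambda>\<omega>. \<Prod>i\<in>I. iexp (t i * (u i \<bullet> V \<omega>))) = expectation (\<lambda>\<omega>. iexp (w \<bullet> V \<omega>))"
    using I by (simp add: w_def inner_sum_left exp_sum sum_distrib_left)
  also have "\<dots> = exp (- ((\<Sum>i\<in>I. t i ^ 2 * ?v i) / 2))"
    unfolding centered_gaussian_char var ..
  also have "\<dots> = complex_of_real (\<Prod>i\<in>I. exp (- (t i ^ 2 * ?v i / 2)))"
    using I by (simp add: exp_sum sum_divide_distrib flip: sum_negf)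
  also have "\<dots> = (\<Prod>i\<in>I. expectation (\<lambda>\<omega>. iexp (t i * (u i \<bullet> V \<omega>))))"
    unfolding of_real_prod
  proof (intro prod.cong refl)
    fix i
    show "complex_of_real (exp (- (t i ^ 2 * ?v i / 2))) = expectation (\<lambda>\<omega>. iexp (t i * (u i \<bullet> V \<omega>)))"
      using centered_gaussian_char[of "t i *\<^sub>R u i"] by (simp add: power_mult_distrib)
  qed
  finally show "expectation (\<lambda>\<omega>. \<Prod>i\<in>I. iexp (t i * (u i \<bullet> V \<omega>))) = (\<Prod>i\<in>I. expectation (\<lambda>\<omega>. iexp (t i * (u i \<bullet> V \<omega>))))" .
qed simp

end

end

section \<open>The product inequality\<close>

lemma std_normal2_moment:
  "(LINT z|std_normal2. fst z ^ j * snd z ^ l) = normal_moment j * normal_moment l"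
proof -
  have "(LINT z|std_normal2. fst z ^ j * snd z ^ l)
      = (LINT x|std_normal_distribution. LINT y|std_normal_distribution. x ^ j * y ^ l)"
    by (subst std_normal_pair.integral_fst)
       (auto simp: case_prod_unfold intro!: integrable_std_normal2_polynomial real_polynomial_function_intros2)
  then show ?thesis by simp
qed

text \<open>The binomial expansion in normal moments. It is matched term by term with the moments of
  \<open>A\<close> and \<open>B\<close> below, and shows at once that odd exponents give 0.\<close>

lemma hyp_moment_expand:
  "hyp_moment c j l n = (\<Sum>k\<le>n. of_nat (n choose k) * (1 + c) ^ k * (- (1 - c)) ^ (n - k)
      * (normal_moment (2 * k + j) * normal_moment (2 * (n - k) + l)))"
proof -
  have eq: "fst z ^ j * snd z ^ l * hyp_form c z ^ n = (\<Sum>k\<le>n. (of_nat (n choose k) * (1 + c) ^ k * (- (1 - c)) ^ (n - k))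
      * (fst z ^ (2 * k + j) * snd z ^ (2 * (n - k) + l)))" for z
  proof -
    have "hyp_form c z = (1 + c) * fst z ^ 2 + (- (1 - c)) * snd z ^ 2" by (simp add: hyp_form_def algebra_simps)
    then have "hyp_form c z ^ n = (\<Sum>k\<le>n. of_nat (n choose k) * ((1 + c) * fst z ^ 2) ^ k * ((- (1 - c)) * snd z ^ 2) ^ (n - k))"
      by (simp only: binomial_ring)
    then show ?thesis
      by (simp only: sum_distrib_left power_mult_distrib power_add power_mult[symmetric] mult_ac)
  qed
  have "hyp_moment c j l n = (\<Sum>k\<le>n. (of_nat (n choose k) * (1 + c) ^ k * (- (1 - c)) ^ (n - k))
      * (LINT z|std_normal2. fst z ^ (2 * k + j) * snd z ^ (2 * (n - k) + l)))"
    unfolding hyp_moment_def eq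
    by (subst Bochner_Integration.integral_sum)
       (intro integrable_mult_right integrable_std_normal2_polynomial real_polynomial_function_intros2, simp)
  then show ?thesis unfolding std_normal2_moment .
qed

lemma hyp_moment_0: "hyp_moment c j l 0 = normal_moment j * normal_moment l"
  by (simp add: hyp_moment_def std_normal2_moment)

lemma hyp_moment_odd: "odd j \<or> odd l \<Longrightarrow> hyp_moment c j l n = 0"
  unfolding hyp_moment_expand
  by (intro sum.neutral) (auto simp: integral_std_normal_distribution_moment_odd)

text \<open>The sign of the weight \<open>\<alpha> ^ i * \<beta> ^ r\<close> is immaterial: odd exponents make both moments vanish.\<close>

lemma hyp_moment_weighted_ge:
  assumes "m \<ge> 1" "even (i + r + q)" "0 \<le> s" "0 \<le> t" "0 \<le> u"
  shows "0 \<le> a ^ i * b ^ r * (s ^ i * t ^ r * (u ^ q * normal_moment q)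
      * (hyp_moment c i r (2 * m) - hyp_bound m * normal_moment i * normal_moment r))"
proof (cases "even i \<and> even r")
  case True
  then have "even q" using assms by auto
  obtain j l where "i = 2 * j" "r = 2 * l" using True by blast
  then have "0 \<le> hyp_moment c i r (2 * m) - hyp_bound m * normal_moment i * normal_moment r"
    using hyp_moment_ge[OF assms(1), of j l c] by simp
  moreover have "a ^ i \<ge> 0" "b ^ r \<ge> 0" using True by (auto simp: zero_le_even_power)
  ultimately show ?thesis
    using assms normal_moment_even_pos[OF \<open>even q\<close>] by (intro mult_nonneg_nonneg) auto
next
  case False
  then have "hyp_moment c i r (2 * m) = 0" "normal_moment i * normal_moment r = 0"
    using hyp_moment_odd integral_std_normal_distribution_moment_odd by auto
  then have "hyp_moment c i r (2 * m) - hyp_bound m * normal_moment i * normal_moment r = 0"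
    by (simp only: mult.assoc mult_zero_right diff_self)
  then show ?thesis by (simp only: mult_zero_right order_refl)
qed

text \<open>The three projections are independent, and at the level of moments A^2 - B^2 behaves
  like \<open>\<tau>\<close> times the form at a standard normal pair. Expanding the power of a A +
  b B + W in both expectations gives the difference term by term.\<close>

lemma (in prob_space) gaussian_product_excess:
  fixes V :: "'a \<Rightarrow> 'b::euclidean_space"
  assumes V: "centered_gaussian_vector M V"
    and uncorrelated: "expectation (\<lambda>\<omega>. (u \<bullet> V \<omega>) * (v \<bullet> V \<omega>)) = 0" "expectation (\<lambda>\<omega>. (u \<bullet> V \<omega>) * (w \<bullet> V \<omega>)) = 0"
      "expectation (\<lambda>\<omega>. (v \<bullet> V \<omega>) * (w \<bullet> V \<omega>)) = 0"
    and s: "s \<ge> 0" "expectation (\<lambda>\<omega>. (u \<bullet> V \<omega>) ^ 2) = s ^ 2" "s ^ 2 = \<tau> * (1 + c)"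
    and t: "t \<ge> 0" "expectation (\<lambda>\<omega>. (v \<bullet> V \<omega>) ^ 2) = t ^ 2" "t ^ 2 = \<tau> * (1 - c)"
    and r: "r \<ge> 0" "expectation (\<lambda>\<omega>. (w \<bullet> V \<omega>) ^ 2) = r ^ 2"
  shows "expectation (\<lambda>\<omega>. ((u \<bullet> V \<omega>) ^ 2 - (v \<bullet> V \<omega>) ^ 2) ^ (2 * m) * (a * (u \<bullet> V \<omega>) + b * (v \<bullet> V \<omega>) + w \<bullet> V \<omega>) ^ n)
      - \<tau> ^ (2 * m) * hyp_bound m * expectation (\<lambda>\<omega>. (a * (u \<bullet> V \<omega>) + b * (v \<bullet> V \<omega>) + w \<bullet> V \<omega>) ^ n)
    = (\<Sum>k\<le>n. \<Sum>i\<le>k. of_nat (n choose k) * of_nat (k choose i) * \<tau> ^ (2 * m) *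
        (a ^ i * b ^ (k - i) * (s ^ i * t ^ (k - i) * (r ^ (n - k) * normal_moment (n - k))
          * (hyp_moment c i (k - i) (2 * m) - hyp_bound m * normal_moment i * normal_moment (k - i)))))"
proof -
  define A B W where "A = (\<lambda>\<omega>. u \<bullet> V \<omega>)" "B = (\<lambda>\<omega>. v \<bullet> V \<omega>)" "W = (\<lambda>\<omega>. w \<bullet> V \<omega>)"
  note ABW = this
  have indep: "indep_vars (\<lambda>_. borel) (\<lambda>i \<omega>. [u, v, w] ! i \<bullet> V \<omega>) {..<3}"
    using uncorrelated
    by (intro centered_gaussian_indep_vars[OF V]) (auto simp: lessThan_nat_numeral lessThan_Suc mult.commute)
  have moment: "expectation (\<lambda>\<omega>. A \<omega> ^ i * B \<omega> ^ j * W \<omega> ^ q) = s ^ i * t ^ j * r ^ q * (normal_moment i * normal_moment j * normal_moment q)" for i j q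
  proof -
    have "indep_vars (\<lambda>_. borel) (\<lambda>k \<omega>. ([u, v, w] ! k \<bullet> V \<omega>) ^ ([i, j, q] ! k)) {..<3}"
      by (rule indep_vars_compose2[OF indep]) simp
    then have "expectation (\<lambda>\<omega>. \<Prod>k\<in>{..<3}. ([u, v, w] ! k \<bullet> V \<omega>) ^ ([i, j, q] ! k))
        = (\<Prod>k\<in>{..<3}. expectation (\<lambda>\<omega>. ([u, v, w] ! k \<bullet> V \<omega>) ^ ([i, j, q] ! k)))"
      by (intro indep_vars_lebesgue_integral) (auto intro: centered_gaussian_integrable_moment[OF V])
    moreover have "expectation (\<lambda>\<omega>. A \<omega> ^ i) = s ^ i * normal_moment i" "expectation (\<lambda>\<omega>. B \<omega> ^ j) = t ^ j * normal_moment j"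
      "expectation (\<lambda>\<omega>. W \<omega> ^ q) = r ^ q * normal_moment q"
      using centered_gaussian_moment[OF V, of u i] centered_gaussian_moment[OF V, of v j]
        centered_gaussian_moment[OF V, of w q] s(1,2) t(1,2) r unfolding ABW by simp_all
    ultimately show ?thesis
      by (simp add: lessThan_nat_numeral lessThan_Suc ABW mult_ac)
  qed
  have int: "integrable M (\<lambda>\<omega>. (A \<omega> ^ 2 - B \<omega> ^ 2) ^ p * (A \<omega> ^ i * B \<omega> ^ j * W \<omega> ^ q))" for i j q p
    unfolding ABW
    by (intro centered_gaussian_integrable_polynomial[OF V, of "\<lambda>x. ((u \<bullet> x) ^ 2 - (v \<bullet> x) ^ 2) ^ p * ((u \<bullet> x) ^ i * (v \<bullet> x) ^ j * (w \<bullet> x) ^ q)"]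
        real_polynomial_function_intros(1-5) real_polynomial_function_inner)
  \<comment> \<open>The comparison substitutes for s^2 and t^2 and never divides by \<open>s\<close>
    or \<open>t\<close>, which vanish when \<open>c\<close> is -1 or 1.\<close>
  have form_moment: "expectation (\<lambda>\<omega>. (A \<omega> ^ 2 - B \<omega> ^ 2) ^ p * (A \<omega> ^ i * B \<omega> ^ j * W \<omega> ^ q))
      = \<tau> ^ p * (s ^ i * t ^ j * r ^ q * normal_moment q * hyp_moment c i j p)" for i j q p
  proof -
    have eq: "(A \<omega> ^ 2 - B \<omega> ^ 2) ^ p * (A \<omega> ^ i * B \<omega> ^ j * W \<omega> ^ q) = (\<Sum>k\<le>p. of_nat (p choose k) * (- 1) ^ (p - k)
        * (A \<omega> ^ (2 * k + i) * B \<omega> ^ (2 * (p - k) + j) * W \<omega> ^ q))" for \<omega>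
    proof -
      have "A \<omega> ^ 2 - B \<omega> ^ 2 = A \<omega> ^ 2 + (- 1) * B \<omega> ^ 2" by simp
      then have "(A \<omega> ^ 2 - B \<omega> ^ 2) ^ p = (\<Sum>k\<le>p. of_nat (p choose k) * (A \<omega> ^ 2) ^ k * ((- 1) * B \<omega> ^ 2) ^ (p - k))"
        by (simp only: binomial_ring)
      then show ?thesis
        by (simp only: sum_distrib_left sum_distrib_right power_mult_distrib power_add power_mult[symmetric] mult_ac)
    qed
    have "expectation (\<lambda>\<omega>. (A \<omega> ^ 2 - B \<omega> ^ 2) ^ p * (A \<omega> ^ i * B \<omega> ^ j * W \<omega> ^ q)) =
       (\<Sum>k\<le>p. of_nat (p choose k) * (- 1) ^ (p - k) * expectation (\<lambda>\<omega>. A \<omega> ^ (2 * k + i) * B \<omega> ^ (2 * (p - k) + j) * W \<omega> ^ q))"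
      unfolding eq
      by (subst Bochner_Integration.integral_sum) (use int[of 0] in \<open>auto intro!: integrable_mult_right simp del: power_Suc\<close>)
    also have "\<dots> = \<tau> ^ p * (s ^ i * t ^ j * r ^ q * normal_moment q * hyp_moment c i j p)"
      unfolding hyp_moment_expand sum_distrib_left moment
    proof (intro sum.cong refl)
      fix k assume "k \<in> {..p}"
      then have "\<tau> ^ p = \<tau> ^ k * \<tau> ^ (p - k)" by (simp flip: power_add)
      moreover have "s ^ (2 * k + i) = \<tau> ^ k * (1 + c) ^ k * s ^ i"
        by (simp add: power_add power_mult s(3) power_mult_distrib)
      moreover have "t ^ (2 * (p - k) + j) = \<tau> ^ (p - k) * (1 - c) ^ (p - k) * t ^ j"
        by (simp add: power_add power_mult t(3) power_mult_distrib)
      ultimately show "of_nat (p choose k) * (- 1) ^ (p - k) * (s ^ (2 * k + i) * t ^ (2 * (p - k) + j) * r ^ q *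
            (normal_moment (2 * k + i) * normal_moment (2 * (p - k) + j) * normal_moment q))
          = \<tau> ^ p * (s ^ i * t ^ j * r ^ q * normal_moment q * (of_nat (p choose k) * (1 + c) ^ k * (- (1 - c)) ^ (p - k)
            * (normal_moment (2 * k + i) * normal_moment (2 * (p - k) + j))))"
        by (simp only: power_minus[of "1 - c"] mult_ac)
    qed
    finally show ?thesis .
  qed
  have expand: "expectation (\<lambda>\<omega>. (A \<omega> ^ 2 - B \<omega> ^ 2) ^ p * (a * A \<omega> + b * B \<omega> + W \<omega>) ^ n)
    = (\<Sum>k\<le>n. \<Sum>i\<le>k. of_nat (n choose k) * of_nat (k choose i) * (a ^ i * b ^ (k - i))
        * expectation (\<lambda>\<omega>. (A \<omega> ^ 2 - B \<omega> ^ 2) ^ p * (A \<omega> ^ i * B \<omega> ^ (k - i) * W \<omega> ^ (n - k))))" for p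
  proof -
    have "(A \<omega> ^ 2 - B \<omega> ^ 2) ^ p * (a * A \<omega> + b * B \<omega> + W \<omega>) ^ n
      = (\<Sum>k\<le>n. \<Sum>i\<le>k. of_nat (n choose k) * of_nat (k choose i) * (a ^ i * b ^ (k - i))
        * ((A \<omega> ^ 2 - B \<omega> ^ 2) ^ p * (A \<omega> ^ i * B \<omega> ^ (k - i) * W \<omega> ^ (n - k))))" for \<omega>
      by (simp only: binomial_ring[of "a * A \<omega> + b * B \<omega>" "W \<omega>"] binomial_ring[of "a * A \<omega>" "b * B \<omega>"]
        sum_distrib_left sum_distrib_right power_mult_distrib mult_ac)
    then show ?thesis using int by simp
  qed
  \<comment> \<open>The power 0 in the second expectation lets \<open>expand\<close> and
    \<open>form_moment\<close> treat both expectations over the same index set.\<close>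
  have "expectation (\<lambda>\<omega>. (A \<omega> ^ 2 - B \<omega> ^ 2) ^ (2 * m) * (a * A \<omega> + b * B \<omega> + W \<omega>) ^ n)
      - \<tau> ^ (2 * m) * hyp_bound m * expectation (\<lambda>\<omega>. (A \<omega> ^ 2 - B \<omega> ^ 2) ^ 0 * (a * A \<omega> + b * B \<omega> + W \<omega>) ^ n)
    = (\<Sum>k\<le>n. \<Sum>i\<le>k. of_nat (n choose k) * of_nat (k choose i) * \<tau> ^ (2 * m) *
        (a ^ i * b ^ (k - i) * (s ^ i * t ^ (k - i) * (r ^ (n - k) * normal_moment (n - k))
          * (hyp_moment c i (k - i) (2 * m) - hyp_bound m * normal_moment i * normal_moment (k - i)))))"
    unfolding expand sum_distrib_left sum_subtractf[symmetric]
  proof (intro sum.cong refl)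
    fix k i
    let ?E = "expectation (\<lambda>\<omega>. (A \<omega> ^ 2 - B \<omega> ^ 2) ^ 0 * (A \<omega> ^ i * B \<omega> ^ (k - i) * W \<omega> ^ (n - k)))"
    let ?F = "of_nat (n choose k) * of_nat (k choose i) * (a ^ i * b ^ (k - i))"
    show "?F * expectation (\<lambda>\<omega>. (A \<omega> ^ 2 - B \<omega> ^ 2) ^ (2 * m) * (A \<omega> ^ i * B \<omega> ^ (k - i) * W \<omega> ^ (n - k)))
        - \<tau> ^ (2 * m) * hyp_bound m * (?F * ?E)
      = of_nat (n choose k) * of_nat (k choose i) * \<tau> ^ (2 * m) *
        (a ^ i * b ^ (k - i) * (s ^ i * t ^ (k - i) * (r ^ (n - k) * normal_moment (n - k))
          * (hyp_moment c i (k - i) (2 * m) - hyp_bound m * normal_moment i * normal_moment (k - i))))"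
      unfolding form_moment unfolding hyp_moment_0 power_0 mult_1 by (simp only: algebra_simps)
  qed
  then show ?thesis by (simp add: ABW)
qed

theorem theorem1p1:
  fixes M :: "'a measure" and X Y Z :: "'a \<Rightarrow> real" and m :: nat
  assumes "prob_space M"
    and "centered_gaussian_vector M (\<lambda>\<omega>. (X \<omega>, Y \<omega>, Z \<omega>))"
    and "prob_space.variance M X > 0"
    and "prob_space.variance M Y > 0"
    and "prob_space.variance M Z > 0"
    and "m \<ge> 1"
  shows "prob_space.expectation M (\<lambda>\<omega>. X \<omega> ^ (2 * m) * Y \<omega> ^ (2 * m) * Z \<omega> ^ (2 * m))
           \<ge> prob_space.expectation M (\<lambda>\<omega>. X \<omega> ^ (2 * m))
             * prob_space.expectation M (\<lambda>\<omega>. Y \<omega> ^ (2 * m))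
             * prob_space.expectation M (\<lambda>\<omega>. Z \<omega> ^ (2 * m))
       \<and> (prob_space.expectation M (\<lambda>\<omega>. X \<omega> ^ (2 * m) * Y \<omega> ^ (2 * m) * Z \<omega> ^ (2 * m))
           = prob_space.expectation M (\<lambda>\<omega>. X \<omega> ^ (2 * m))
             * prob_space.expectation M (\<lambda>\<omega>. Y \<omega> ^ (2 * m))
             * prob_space.expectation M (\<lambda>\<omega>. Z \<omega> ^ (2 * m))
          \<longleftrightarrow> prob_space.indep_vars M (\<lambda>_. borel) (\<lambda>i. [X, Y, Z] ! i) {..<3})"
proof -
  interpret prob_space M by fact
  define V where "V = (\<lambda>\<omega>. (X \<omega>, Y \<omega>, Z \<omega>))"
  have V: "centered_gaussian_vector M V" using assms(2) by (simp add: V_def)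
  define uX uY uZ :: "real \<times> real \<times> real" where "uX = (1, 0, 0)" and "uY = (0, 1, 0)" and "uZ = (0, 0, 1)"
  have proj: "uX \<bullet> V \<omega> = X \<omega>" "uY \<bullet> V \<omega> = Y \<omega>" "uZ \<bullet> V \<omega> = Z \<omega>" for \<omega>
    by (simp_all add: V_def uX_def uY_def uZ_def)
  define cov where "cov p q = expectation (\<lambda>\<omega>. (p \<bullet> V \<omega>) * (q \<bullet> V \<omega>))" for p q
  have int: "integrable M (\<lambda>\<omega>. (p \<bullet> V \<omega>) * (q \<bullet> V \<omega>))" for p q
    by (rule centered_gaussian_integrable_mult[OF V])
  have cov_sym: "cov p q = cov q p" for p q by (simp add: cov_def mult.commute)
  have cov_add: "cov (p + p') q = cov p q + cov p' q" "cov q (p + p') = cov q p + cov q p'" for p p' q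
    using int by (simp_all add: cov_def inner_add_left distrib_left distrib_right)
  have cov_diff: "cov (p - p') q = cov p q - cov p' q" "cov q (p - p') = cov q p - cov q p'" for p p' q
    using int by (simp_all add: cov_def inner_diff_left left_diff_distrib right_diff_distrib)
  have cov_scale: "cov (a *\<^sub>R p) q = a * cov p q" "cov q (a *\<^sub>R p) = a * cov q p" for a p q
    using int by (simp_all add: cov_def mult.assoc mult.left_commute)
  note cov_simps = cov_add cov_diff cov_scale
  have cov_nonneg: "cov p p \<ge> 0" for p
    by (auto simp: cov_def)
  \<comment> \<open>A direction of zero variance is almost surely 0; this covers singular covariance
    matrices.\<close>
  have cov_null: "cov q p = 0" if "cov p p = 0" for p q
  proof -
    have "AE \<omega> in M. (p \<bullet> V \<omega>) * (p \<bullet> V \<omega>) = 0"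
      using that int integral_nonneg_eq_0_iff_AE[of M "\<lambda>\<omega>. (p \<bullet> V \<omega>) * (p \<bullet> V \<omega>)"] by (simp add: cov_def)
    then have "AE \<omega> in M. (q \<bullet> V \<omega>) * (p \<bullet> V \<omega>) = 0" by eventually_elim simp
    then show ?thesis unfolding cov_def by (rule integral_eq_zero_AE)
  qed
  have cov_square: "expectation (\<lambda>\<omega>. (p \<bullet> V \<omega>) ^ 2) = cov p p" for p
    by (simp add: cov_def power2_eq_square)
  have moment: "expectation (\<lambda>\<omega>. (p \<bullet> V \<omega>) ^ n) = sqrt (cov p p) ^ n * normal_moment n" for p n
    unfolding centered_gaussian_moment[OF V, of p n] cov_square ..
  have mean: "expectation (\<lambda>\<omega>. p \<bullet> V \<omega>) = 0" for p
    using moment[of p 1] integral_std_normal_distribution_moment_odd[of 1] by simp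
  have "variance (\<lambda>\<omega>. p \<bullet> V \<omega>) = cov p p" for p
    unfolding mean by (simp add: cov_square)
  from this[of uX] this[of uY] this[of uZ]
  have pos: "cov uX uX > 0" "cov uY uY > 0" "cov uZ uZ > 0"
    using assms(3-5) unfolding proj by simp_all
  define s t where "s = sqrt (cov uX uX)" and "t = sqrt (cov uY uY)"
  have st: "s > 0" "t > 0" "cov uX uX = s ^ 2" "cov uY uY = t ^ 2" using pos by (simp_all add: s_def t_def)
  define c where "c = cov uX uY / (s * t)"
  have c: "cov uX uY = s * t * c" using st by (simp add: c_def)
  define \<tau> where "\<tau> = 2 * s ^ 2 * t ^ 2"
  \<comment> \<open>The sum and difference of the normalised variables, multiplied by
    \<open>s * t\<close>; equal variances of the two summands make them uncorrelated.\<close>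
  define uA uB where "uA = t *\<^sub>R uX + s *\<^sub>R uY" and "uB = t *\<^sub>R uX - s *\<^sub>R uY"
  have AA: "cov uA uA = \<tau> * (1 + c)" and BB: "cov uB uB = \<tau> * (1 - c)" and AB: "cov uA uB = 0"
    by (simp_all add: uA_def uB_def cov_simps st c cov_sym[of uY uX] \<tau>_def algebra_simps power2_eq_square)
  \<comment> \<open>Regression coefficients of \<open>Z\<close>. If a variance is 0, division by
    zero gives coefficient 0, which is right by \<open>cov_null\<close>.\<close>
  define \<alpha> \<beta> where "\<alpha> = cov uZ uA / cov uA uA" and "\<beta> = cov uZ uB / cov uB uB"
  have \<alpha>: "\<alpha> * cov uA uA = cov uZ uA" and \<beta>: "\<beta> * cov uB uB = cov uZ uB"
    using cov_null[of uA uZ] cov_null[of uB uZ] by (auto simp: \<alpha>_def \<beta>_def)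
  define uW where "uW = uZ - \<alpha> *\<^sub>R uA - \<beta> *\<^sub>R uB"
  have AW: "cov uA uW = 0" and BW: "cov uB uW = 0"
    by (simp_all add: uW_def cov_simps \<alpha> \<beta> AB cov_sym[of uB uA] cov_sym[of _ uZ])
  define a b r where "a = sqrt (cov uA uA)" and "b = sqrt (cov uB uB)" and "r = sqrt (cov uW uW)"
  have abr: "a \<ge> 0" "b \<ge> 0" "r \<ge> 0" "cov uA uA = a ^ 2" "cov uB uB = b ^ 2" "cov uW uW = r ^ 2"
    using cov_nonneg by (simp_all add: a_def b_def r_def)
  define T where "T k i = of_nat (2 * m choose k) * of_nat (k choose i) * \<tau> ^ (2 * m) *
        (\<alpha> ^ i * \<beta> ^ (k - i) * (a ^ i * b ^ (k - i) * (r ^ (2 * m - k) * normal_moment (2 * m - k))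
          * (hyp_moment c i (k - i) (2 * m) - hyp_bound m * normal_moment i * normal_moment (k - i))))" for k i
  define S where "S = (\<Sum>k\<le>2 * m. \<Sum>i\<le>k. T k i)"
  let ?L = "expectation (\<lambda>\<omega>. X \<omega> ^ (2 * m) * Y \<omega> ^ (2 * m) * Z \<omega> ^ (2 * m))"
  let ?R = "expectation (\<lambda>\<omega>. X \<omega> ^ (2 * m)) * expectation (\<lambda>\<omega>. Y \<omega> ^ (2 * m)) * expectation (\<lambda>\<omega>. Z \<omega> ^ (2 * m))"
  have excess: "(4 * s * t) ^ (2 * m) * (?L - ?R) = S"
  proof -
    have form: "(uA \<bullet> V \<omega>) ^ 2 - (uB \<bullet> V \<omega>) ^ 2 = 4 * s * t * (X \<omega> * Y \<omega>)" for \<omega>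
      by (simp add: uA_def uB_def inner_add_left inner_diff_left proj algebra_simps power2_eq_square)
    have Z: "\<alpha> * (uA \<bullet> V \<omega>) + \<beta> * (uB \<bullet> V \<omega>) + uW \<bullet> V \<omega> = Z \<omega>" for \<omega>
      by (simp add: uW_def inner_diff_left proj)
    have sq: "expectation (\<lambda>\<omega>. (uA \<bullet> V \<omega>) ^ 2) = a ^ 2" "expectation (\<lambda>\<omega>. (uB \<bullet> V \<omega>) ^ 2) = b ^ 2"
      "expectation (\<lambda>\<omega>. (uW \<bullet> V \<omega>) ^ 2) = r ^ 2" "a ^ 2 = \<tau> * (1 + c)" "b ^ 2 = \<tau> * (1 - c)"
      using AA BB unfolding cov_square abr by simp_all
    note gaussian_product_excess[OF V AB[unfolded cov_def] AW[unfolded cov_def] BW[unfolded cov_def]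
          abr(1) sq(1,4) abr(2) sq(2,5) abr(3) sq(3), of m \<alpha> \<beta> "2 * m", unfolded form Z]
    then have "expectation (\<lambda>\<omega>. (4 * s * t * (X \<omega> * Y \<omega>)) ^ (2 * m) * Z \<omega> ^ (2 * m))
        - \<tau> ^ (2 * m) * hyp_bound m * expectation (\<lambda>\<omega>. Z \<omega> ^ (2 * m)) = S"
      unfolding S_def T_def .
    also have "expectation (\<lambda>\<omega>. (4 * s * t * (X \<omega> * Y \<omega>)) ^ (2 * m) * Z \<omega> ^ (2 * m)) = (4 * s * t) ^ (2 * m) * ?L"
      by (simp add: power_mult_distrib mult.assoc)
    also have "\<tau> ^ (2 * m) * hyp_bound m * expectation (\<lambda>\<omega>. Z \<omega> ^ (2 * m)) = (4 * s * t) ^ (2 * m) * ?R"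
    proof -
      \<comment> \<open>Both sides are 16 s^4 t^4; the m-th power turns the bound into the product
        of the moments of \<open>X\<close> and \<open>Y\<close>.\<close>
      have "\<tau> ^ 2 * 4 = (4 * s * t) ^ 2 * s ^ 2 * t ^ 2"
        by (simp add: \<tau>_def power2_eq_square)
      then have "(\<tau> ^ 2 * 4) ^ m = ((4 * s * t) ^ 2 * s ^ 2 * t ^ 2) ^ m" by simp
      then have "\<tau> ^ (2 * m) * 4 ^ m = (4 * s * t) ^ (2 * m) * s ^ (2 * m) * t ^ (2 * m)"
        unfolding power_mult power_mult_distrib[of _ _ m] .
      then have "\<tau> ^ (2 * m) * hyp_bound m = (4 * s * t) ^ (2 * m) * s ^ (2 * m) * t ^ (2 * m) * normal_moment (2 * m) ^ 2"
        by (simp only: mult.assoc[symmetric])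
      moreover have "expectation (\<lambda>\<omega>. X \<omega> ^ (2 * m)) = s ^ (2 * m) * normal_moment (2 * m)"
        "expectation (\<lambda>\<omega>. Y \<omega> ^ (2 * m)) = t ^ (2 * m) * normal_moment (2 * m)"
        using moment[of uX "2 * m"] moment[of uY "2 * m"] unfolding proj s_def t_def by auto
      ultimately show ?thesis by (simp only: power2_eq_square mult_ac)
    qed
    finally show ?thesis by (simp only: right_diff_distrib)
  qed
  have \<tau>: "\<tau> > 0" using st by (simp add: \<tau>_def)
  have T_nonneg: "T k i \<ge> 0" if "k \<le> 2 * m" "i \<le> k" for k i
    unfolding T_def using that \<tau> abr(1-3)
    by (intro mult_nonneg_nonneg hyp_moment_weighted_ge[OF assms(6)]) auto
  then have "S \<ge> 0" unfolding S_def by (intro sum_nonneg) auto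
  have scale: "(4 * s * t) ^ (2 * m) > 0" using st by simp
  then have "?L - ?R \<ge> 0"
    using \<open>S \<ge> 0\<close> unfolding excess[symmetric] by (simp only: zero_le_mult_iff) linarith
  then have ge: "?L \<ge> ?R" by simp
  have eq: "?L = ?R \<longleftrightarrow> S = 0"
    using scale unfolding excess[symmetric] mult_eq_0_iff by linarith
  have "indep_vars (\<lambda>_. borel) (\<lambda>i. [X, Y, Z] ! i) {..<3}" if "S = 0"
  proof -
    \<comment> \<open>Nonnegative terms with sum 0 all vanish; three of them decide the equality
      case.\<close>
    have T_0: "T k i = 0" if "k \<le> 2 * m" "i \<le> k" for k i
    proof -
      have "\<forall>k\<in>{..2 * m}. (\<Sum>i\<le>k. T k i) = 0"
        using \<open>S = 0\<close> T_nonneg unfolding S_def by (subst (asm) sum_nonneg_eq_0_iff) (auto intro!: sum_nonneg)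
      then have "(\<Sum>i\<le>k. T k i) = 0" using that by auto
      then have "\<forall>i\<in>{..k}. T k i = 0"
        using T_nonneg that by (subst (asm) sum_nonneg_eq_0_iff) auto
      then show ?thesis using that by auto
    qed
    have std_normal_UNIV: "std_normal.prob UNIV = 1" using std_normal.prob_space by simp
    \<comment> \<open>The term in A^(2 m) alone: its gap is strictly positive because the exponent
      is, so the coefficient must vanish. The term in B^(2 m) is treated in the same way.\<close>
    have "\<alpha> ^ (2 * m) * a ^ (2 * m) = 0"
      using T_0[of "2 * m" "2 * m"] \<tau> hyp_moment_gt[OF assms(6), of m 0 c] assms(6) by (auto simp: T_def std_normal_UNIV)
    then have ZA: "cov uZ uA = 0" using \<alpha> abr(4) by auto
    have "\<beta> ^ (2 * m) * b ^ (2 * m) = 0"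
      using T_0[of "2 * m" 0] \<tau> hyp_moment_gt[OF assms(6), of 0 m c] assms(6) by (auto simp: T_def std_normal_UNIV)
    then have ZB: "cov uZ uB = 0" using \<beta> abr(5) by auto
    have "uW = uZ" using ZA ZB by (simp add: uW_def \<alpha>_def \<beta>_def)
    then have "r > 0" using pos(3) by (simp add: r_def)
    \<comment> \<open>Now W = Z has positive variance, so the term free of \<open>A\<close> and
      \<open>B\<close> forces the gap at exponents 0 to vanish.\<close>
    then have "c = 0"
      using T_0[of 0 0] \<tau> hyp_moment_00_gt[OF assms(6), of c] normal_moment_even_pos[of "2 * m"]
      by (auto simp: T_def std_normal_UNIV)
    then have XY: "cov uX uY = 0" using c by simp
    have "t * cov uZ uX = 0" "s * cov uZ uY = 0"
      using ZA ZB by (simp_all add: uA_def uB_def cov_simps)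
    then have ZX: "cov uZ uX = 0" and ZY: "cov uZ uY = 0" using st by simp_all
    have "indep_vars (\<lambda>_. borel) (\<lambda>i \<omega>. [uX, uY, uZ] ! i \<bullet> V \<omega>) {..<3}"
      using XY ZX ZY
      by (intro centered_gaussian_indep_vars[OF V])
         (auto simp: lessThan_nat_numeral lessThan_Suc cov_sym simp flip: cov_def)
    then show ?thesis
      by (rule indep_vars_cong[THEN iffD1, rotated -1])
         (auto simp: lessThan_nat_numeral lessThan_Suc proj)
  qed
  moreover have "?L = ?R" if indep: "indep_vars (\<lambda>_. borel) (\<lambda>i. [X, Y, Z] ! i) {..<3}"
  proof -
    have pow: "integrable M (\<lambda>\<omega>. X \<omega> ^ (2 * m))" "integrable M (\<lambda>\<omega>. Y \<omega> ^ (2 * m))" "integrable M (\<lambda>\<omega>. Z \<omega> ^ (2 * m))"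
      using centered_gaussian_integrable_moment[OF V, of uX "2 * m"] centered_gaussian_integrable_moment[OF V, of uY "2 * m"]
        centered_gaussian_integrable_moment[OF V, of uZ "2 * m"] unfolding proj by auto
    have "indep_vars (\<lambda>_. borel) (\<lambda>i \<omega>. ([X, Y, Z] ! i) \<omega> ^ (2 * m)) {..<3}"
      by (rule indep_vars_compose2[OF indep]) simp
    then have "expectation (\<lambda>\<omega>. \<Prod>i\<in>{..<3}. ([X, Y, Z] ! i) \<omega> ^ (2 * m)) = (\<Prod>i\<in>{..<3}. expectation (\<lambda>\<omega>. ([X, Y, Z] ! i) \<omega> ^ (2 * m)))"
      using pow by (intro indep_vars_lebesgue_integral) (auto simp: lessThan_nat_numeral lessThan_Suc)
    then show ?thesis by (simp add: lessThan_nat_numeral lessThan_Suc mult_ac)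
  qed
  ultimately show ?thesis using ge eq by blast
qed

end
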